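(* Let $\eta$ be a max-i.d. process on a locally compact metric space $T$ with exponent measure $\mu$. Then, for all disjoint closed subsets $S_1,S_2\subset T$, $$\beta(S_1,S_2)\leq 2\int_{\mathbb{C}_0(T)}\mathbb{P}\big[f\not<_{S_1}\eta,\ f\not<_{S_2}\eta\big]\,\mu(df).$$
   Context: Setting. $(\Omega,\mathcal F,\mathbb P)$ is a probability space and $T$ is a locally compact metric space. $\mathbb C(T)=\mathbb C(T,[0,+\infty))$ is the space of nonnegative continuous functions on $T$ with the topology of uniform convergence on compact sets and its Borel $\sigma$-field, and $\mathbb C_0(T)=\mathbb C(T)\setminus\{0\}$. $\mu$ is a locally finite Borel measure on $\mathbb C_0(T)$ such that $\mu[\{f\in\mathbb C_0(T):\ \sup_K f>\varepsilon\}]<\infty$ for all compact $K\subset T$ and all $\varepsilon>0$. $\Phi$ is a Poisson point process on $\mathbb C_0(T)$ with intensity $\mu$ (regarded as a random set of points with possible repetitions). The max-i.d. process on $T$ with exponent measure $\mu$ is the sample continuous random process $\eta(t)=\max\{\phi(t):\ \phi\in\Phi\}$, $t\in T$, with the convention that the maximum of the empty set is $0$. Notation. For functions $f_1,f_2$ defined at least on $S$: $f_1<_S f_2$ means $f_1(s)<f_2(s)$ for all $s\in S$; $f_1\not<_S f_2$ means there exists $s\in S$ with $f_1(s)\ge f_2(s)$. Mixing coefficient. For closed $S\subset T$, $\mathcal P_S$ is the distribution of the restriction $\eta_S$ of $\eta$ to $S$, on the space $\mathbb C(S)$ of continuous functions on $S$ with its Borel $\sigma$-field $\mathcal C_S$.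 For disjoint closed $S_1,S_2$, $\mathbb C(S_1\cup S_2)$ is identified with $\mathbb C(S_1)\times\mathbb C(S_2)$, and $$\beta(S_1,S_2)=\sup\{|\mathcal P_{S_1\cup S_2}(C)-(\mathcal P_{S_1}\otimes\mathcal P_{S_2})(C)|:\ C\in\mathcal C_{S_1\cup S_2}\}.$$
   Formalization: The union of S_1 and S_2 is assumed second countable (automatic when T is separable); without this the product law need not be defined on all Borel sets of C(S_1 ∪ S_2), so β, and the probabilities on the right, can be undefined. *)

theory Defs
  imports "HOL-Probability.Probability"
begin

text \<open>
  The nonnegative continuous functions on \<open>S\<close>. As usual for function spaces on a subset, a function
  on \<open>S\<close> is represented by its extension with value \<^const>\<open>undefined\<close> outside \<open>S\<close>; for
  \<open>S = UNIV\<close> this is no restriction.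
\<close>

definition cont_fun :: "'a::metric_space set \<Rightarrow> ('a \<Rightarrow> real) set" where
  "cont_fun S = {f \<in> extensional S. continuous_on S f \<and> (\<forall>t\<in>S. 0 \<le> f t)}"

definition unif_nbhd :: "'a::metric_space set \<Rightarrow> 'a set \<Rightarrow> real \<Rightarrow> ('a \<Rightarrow> real) \<Rightarrow> ('a \<Rightarrow> real) set" where
  "unif_nbhd S K e f = {g \<in> cont_fun S. \<forall>t\<in>K. \<bar>g t - f t\<bar> < e}"

text \<open>Uniform convergence on the compact subsets of \<open>S\<close>.\<close>

definition compact_conv_topology :: "'a::metric_space set \<Rightarrow> ('a \<Rightarrow> real) topology" where
  "compact_conv_topology S = topology (\<lambda>U. U \<subseteq> cont_fun S \<and>
     (\<forall>f\<in>U. \<exists>K e. compact K \<and> K \<subseteq> S \<and> 0 < e \<and> unif_nbhd S K e f \<subseteq> U))"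

lemma openin_compact_conv_topology:
  "openin (compact_conv_topology S) U \<longleftrightarrow> U \<subseteq> cont_fun S \<and>
     (\<forall>f\<in>U. \<exists>K e. compact K \<and> K \<subseteq> S \<and> 0 < e \<and> unif_nbhd S K e f \<subseteq> U)"
proof -
  define Q where "Q = (\<lambda>U f. \<exists>K e. compact K \<and> K \<subseteq> S \<and> 0 < e \<and> unif_nbhd S K e f \<subseteq> U)"
  define P where "P = (\<lambda>U. U \<subseteq> cont_fun S \<and> (\<forall>f\<in>U. Q U f))"
  have mono: "Q V f" if "Q U f" "U \<subseteq> V" for U V f
    using that unfolding Q_def by (meson order_trans)
  have QInt: "Q (U \<inter> V) f" if "Q U f" "Q V f" for U V f
  proof -
    obtain K d where K: "compact K" "K \<subseteq> S" "0 < d" "unif_nbhd S K d f \<subseteq> U"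
      using \<open>Q U f\<close> unfolding Q_def by auto
    obtain L e where L: "compact L" "L \<subseteq> S" "0 < e" "unif_nbhd S L e f \<subseteq> V"
      using \<open>Q V f\<close> unfolding Q_def by auto
    have sub: "unif_nbhd S (K \<union> L) (min d e) f \<subseteq> unif_nbhd S K d f"
      "unif_nbhd S (K \<union> L) (min d e) f \<subseteq> unif_nbhd S L e f"
      unfolding unif_nbhd_def by auto
    show ?thesis
      unfolding Q_def
    proof (intro exI conjI)
      show "compact (K \<union> L)" using K L by (simp add: compact_Un)
      show "K \<union> L \<subseteq> S" using K L by simp
      show "0 < min d e" using K L by simp
      show "unif_nbhd S (K \<union> L) (min d e) f \<subseteq> U \<inter> V"
        using order_trans[OF sub(1) K(4)] order_trans[OF sub(2) L(4)] by (rule Int_greatest)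
    qed
  qed
  have "istopology P"
    unfolding istopology_def
  proof (intro conjI allI impI)
    fix U V assume "P U" "P V"
    then show "P (U \<inter> V)" using QInt unfolding P_def by auto
  next
    fix \<U> assume U: "\<forall>U\<in>\<U>. P U"
    have "Q (\<Union>\<U>) f" if "U \<in> \<U>" "f \<in> U" for U f
      using mono[of U f "\<Union>\<U>"] U that unfolding P_def by auto
    moreover have "\<Union>\<U> \<subseteq> cont_fun S"
      using U unfolding P_def by auto
    ultimately show "P (\<Union>\<U>)" unfolding P_def by auto
  qed
  moreover have "compact_conv_topology S = topology P"
    unfolding compact_conv_topology_def P_def Q_def ..
  ultimately show ?thesis
    by (simp add: topology_inverse' P_def Q_def)
qed

lemma topspace_compact_conv_topology [simp]: "topspace (compact_conv_topology S) = cont_fun S"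
proof
  show "topspace (compact_conv_topology S) \<subseteq> cont_fun S"
    using openin_topspace[of "compact_conv_topology S"]
    unfolding openin_compact_conv_topology by (rule conjunct1)
  have "\<exists>K e. compact K \<and> K \<subseteq> S \<and> 0 < e \<and> unif_nbhd S K e f \<subseteq> cont_fun S" for f
    by (rule exI[of _ "{}"], rule exI[of _ 1]) (auto simp: unif_nbhd_def)
  then have "openin (compact_conv_topology S) (cont_fun S)"
    by (simp add: openin_compact_conv_topology)
  then show "cont_fun S \<subseteq> topspace (compact_conv_topology S)"
    by (rule openin_subset)
qed

definition borel_sigma :: "'x topology \<Rightarrow> 'x measure" where
  "borel_sigma X = sigma (topspace X) {U. openin X U}"

definition nonzero_topology :: "('a::metric_space \<Rightarrow> real) topology" where
  "nonzero_topology = subtopology (compact_conv_topology UNIV) (cont_fun UNIV - {\<lambda>_. 0})"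

definition exponent_measure :: "('a::metric_space \<Rightarrow> real) measure \<Rightarrow> bool" where
  "exponent_measure \<mu> \<longleftrightarrow>
     space \<mu> = space (borel_sigma nonzero_topology) \<and>
     sets \<mu> = sets (borel_sigma nonzero_topology) \<and>
     (\<forall>f \<in> space \<mu>. \<exists>U. openin nonzero_topology U \<and> f \<in> U \<and> emeasure \<mu> U < \<infinity>) \<and>
     (\<forall>K e. compact K \<and> K \<noteq> {} \<and> 0 < e \<longrightarrow>
        emeasure \<mu> {f \<in> space \<mu>. e < (SUP t\<in>K. f t)} < \<infinity>)"

text \<open>
  A random set of points with possible repetitions is given by its multiplicities: \<open>\<Phi> \<omega> x\<close> is the
  number of times the point \<open>x\<close> occurs in the configuration \<open>\<Phi> \<omega>\<close>.
\<close>

definition num_points :: "('x \<Rightarrow> nat) \<Rightarrow> 'x set \<Rightarrow> ennreal" where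
  "num_points m A = emeasure (point_measure UNIV (\<lambda>x. of_nat (m x))) A"

text \<open>
  The Poisson law with parameter \<open>\<infinity>\<close> is concentrated at \<open>\<infinity>\<close>. The library's \<^const>\<open>poisson_pmf\<close>
  is not used because it leaves out the parameter \<open>0\<close>.
\<close>

definition poisson_point_process ::
    "'w measure \<Rightarrow> 'x measure \<Rightarrow> ('w \<Rightarrow> 'x \<Rightarrow> nat) \<Rightarrow> bool" where
  "poisson_point_process M \<mu> \<Phi> \<longleftrightarrow>
     (\<forall>\<omega>\<in>space M. \<forall>x. 0 < \<Phi> \<omega> x \<longrightarrow> x \<in> space \<mu>) \<and>
     (\<forall>A\<in>sets \<mu>. (\<lambda>\<omega>. num_points (\<Phi> \<omega>) A) \<in> borel_measurable M) \<and>
     (\<forall>A\<in>sets \<mu>. emeasure \<mu> A < \<infinity> \<longrightarrow>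
        (\<forall>k::nat. measure M {\<omega>\<in>space M. num_points (\<Phi> \<omega>) A = of_nat k} =
           measure \<mu> A ^ k / fact k * exp (- measure \<mu> A))) \<and>
     (\<forall>A\<in>sets \<mu>. emeasure \<mu> A = \<infinity> \<longrightarrow> (AE \<omega> in M. num_points (\<Phi> \<omega>) A = \<infinity>)) \<and>
     (\<forall>n (A :: nat \<Rightarrow> 'x set). (\<forall>i<n. A i \<in> sets \<mu>) \<and> disjoint_family_on A {..<n} \<longrightarrow>
        prob_space.indep_vars M (\<lambda>_. borel) (\<lambda>i \<omega>. num_points (\<Phi> \<omega>) (A i)) {..<n})"

text \<open>
  \<open>\<eta>\<close> is the sample continuous process of pointwise maxima of the points of \<open>\<Phi>\<close>. The maximum may be
  over an infinite set of values (accumulating at \<open>0\<close>), so \<^const>\<open>Max\<close> does not apply.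
\<close>

definition max_process ::
    "'w measure \<Rightarrow> ('w \<Rightarrow> ('a::metric_space \<Rightarrow> real) \<Rightarrow> nat) \<Rightarrow> ('w \<Rightarrow> 'a \<Rightarrow> real) \<Rightarrow> bool" where
  "max_process M \<Phi> \<eta> \<longleftrightarrow>
     (\<forall>\<omega>\<in>space M. \<eta> \<omega> \<in> cont_fun UNIV) \<and>
     (\<forall>\<omega>\<in>space M. \<forall>t. let V = {f t | f. 0 < \<Phi> \<omega> f} in
        if V = {} then \<eta> \<omega> t = 0 else \<eta> \<omega> t \<in> V \<and> (\<forall>v\<in>V. v \<le> \<eta> \<omega> t))"

definition max_id_process ::
    "'w measure \<Rightarrow> ('a::metric_space \<Rightarrow> real) measure \<Rightarrow> ('w \<Rightarrow> ('a \<Rightarrow> real) \<Rightarrow> nat) \<Rightarrow>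
     ('w \<Rightarrow> 'a \<Rightarrow> real) \<Rightarrow> bool" where
  "max_id_process M \<mu> \<Phi> \<eta> \<longleftrightarrow>
     exponent_measure \<mu> \<and> poisson_point_process M \<mu> \<Phi> \<and> max_process M \<Phi> \<eta>"

definition not_less_on :: "'a set \<Rightarrow> ('a \<Rightarrow> real) \<Rightarrow> ('a \<Rightarrow> real) \<Rightarrow> bool" where
  "not_less_on S f g \<longleftrightarrow> (\<exists>s\<in>S. g s \<le> f s)"

definition law_on ::
    "'w measure \<Rightarrow> ('w \<Rightarrow> 'a::metric_space \<Rightarrow> real) \<Rightarrow> 'a set \<Rightarrow> ('a \<Rightarrow> real) measure" where
  "law_on M \<eta> S = distr M (borel_sigma (compact_conv_topology S)) (\<lambda>\<omega>. restrict (\<eta> \<omega>) S)"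

text \<open>
  The image under \<open>h \<mapsto> (h|S1, h|S2)\<close> identifies a set of functions on \<open>S1 \<union> S2\<close> with a set of
  pairs. The product measure can be evaluated on the image of every Borel set only if the Borel
  sigma-field of \<open>S1 \<union> S2\<close> is identified with the product of those of \<open>S1\<close> and \<open>S2\<close>. This holds if
  \<open>S1 \<union> S2\<close> is second countable, as it always is in a separable (equivalently, sigma-compact) space
  \<open>T\<close>, but fails in general: for discrete \<open>S1\<close> and \<open>S2\<close> of the same cardinality, larger than that
  of the continuum, \<open>h|S1 = h|S2\<close> (through a bijection) defines a closed set of functions that is
  not in the product sigma-field.
\<close>

definition beta_coeff ::
    "'w measure \<Rightarrow> ('w \<Rightarrow> 'a::metric_space \<Rightarrow> real) \<Rightarrow> 'a set \<Rightarrow> 'a set \<Rightarrow> real" where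
  "beta_coeff M \<eta> S1 S2 =
     (SUP C \<in> sets (borel_sigma (compact_conv_topology (S1 \<union> S2))).
        \<bar>measure (law_on M \<eta> (S1 \<union> S2)) C -
         measure (law_on M \<eta> S1 \<Otimes>\<^sub>M law_on M \<eta> S2) ((\<lambda>h. (restrict h S1, restrict h S2)) ` C)\<bar>)"

end

theory Submission
  imports Defs
begin

text \<open>
  By approximation it suffices to consider events that depend only on whether \<open>d \<le> \<eta> t\<close>, for
  finitely many \<open>t\<close> and thresholds \<open>d > 0\<close>. Rounding all values down to the thresholds leaves
  finitely many types \<open>g\<close> of relevant functions, which occur independently with probability
  \<open>p g = 1 - exp (- \<mu> (A g)) \<le> \<mu> (A g)\<close>, where \<open>A g\<close> is the set of functions of type \<open>g\<close>. Whether the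
  maximum on \<open>S1\<close> takes a given value depends only on the types that reach it somewhere on \<open>S1\<close>.
  Resampling these types therefore makes the maximum on \<open>S2\<close> independent of the one on \<open>S1\<close>, and
  changes it only if a removed or an added type reaches the maximum both on \<open>S1\<close> and on \<open>S2\<close>. As
  this property of \<open>g\<close> does not depend on the occurrence of \<open>g\<close> itself, either case has
  probability at most the sum over \<open>g\<close> of \<open>p g\<close> times the probability that \<open>g\<close> reaches the maximum
  on both sets. Refining the thresholds removes the rounding.
\<close>

subsection \<open>Resampling independent points\<close>

text \<open>The thresholds are positive because the exponent measure may be infinite near the zero
  function: only sets such as \<open>{f. d \<le> f t}\<close> with \<open>d > 0\<close> are sure to
  have finite mass. Hence only types that reach a threshold are recorded. Rounding down preserves
  every relation \<open>\<eta> t \<le> f t\<close> and may create false ones. The discretised bounds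
  therefore approach their limit from above, and this passage needs a finite integral to start from.
  The bound for cylinder events has the same right-hand side for all of them. It survives the
  approximation of a Borel set by cylinders in symmetric difference, which is possible because
  evaluations generate the Borel sigma-field when \<open>S1 \<union> S2\<close> is second countable.
  The mixing coefficient compares laws on two different spaces, functions on
  \<open>S1 \<union> S2\<close> and pairs of functions. Gluing carries the product law over to
  functions on \<open>S1 \<union> S2\<close>, so that both laws can be compared on one algebra of
  sets.\<close>

definition max_at :: "('a \<Rightarrow> real) set \<Rightarrow> 'a \<Rightarrow> real" where
  "max_at x t = Max (insert 0 ((\<lambda>g. g t) ` x))"

text \<open>The condition \<open>0 < g t\<close> excludes ties at the value 0. After rounding, a
  function can then hit only if it reaches a threshold at some point of \<open>F\<close>; for finite
  \<open>F\<close> such functions have finite exponent measure.\<close>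

definition hits :: "'a set \<Rightarrow> ('a \<Rightarrow> real) \<Rightarrow> ('a \<Rightarrow> real) \<Rightarrow> bool" where
  "hits F g u \<longleftrightarrow> (\<exists>t\<in>F. 0 < g t \<and> u t \<le> g t)"

text \<open>For \<open>x \<subseteq> G\<close>, the probability that a random subset of
  \<open>G\<close>, which contains each \<open>g\<close> independently with probability
  \<open>p g\<close>, equals \<open>x\<close>.\<close>

definition subset_weight :: "'b set \<Rightarrow> ('b \<Rightarrow> real) \<Rightarrow> 'b set \<Rightarrow> real" where
  "subset_weight G p x = (\<Prod>g\<in>G. if g \<in> x then p g else 1 - p g)"

lemma max_at_nonneg: "finite x \<Longrightarrow> 0 \<le> max_at x t"
  unfolding max_at_def by simp

lemma max_at_upper: "finite x \<Longrightarrow> g \<in> x \<Longrightarrow> g t \<le> max_at x t"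
  unfolding max_at_def by simp

lemma max_at_le: "finite x \<Longrightarrow> 0 \<le> c \<Longrightarrow> (\<And>g. g \<in> x \<Longrightarrow> g t \<le> c) \<Longrightarrow> max_at x t \<le> c"
  unfolding max_at_def by auto

lemma max_at_attained:
  assumes "finite x" "0 < max_at x t"
  obtains g where "g \<in> x" "g t = max_at x t"
proof -
  have "max_at x t \<in> insert 0 ((\<lambda>g. g t) ` x)"
    unfolding max_at_def using assms(1) by (intro Max_in) auto
  then show ?thesis using assms(2) that by force
qed

lemma hits_cong: "(\<And>t. t \<in> F \<Longrightarrow> u t = v t) \<Longrightarrow> hits F g u = hits F g v"
  unfolding hits_def by auto

text \<open>If adding \<open>g\<close> raises the maximum at \<open>t\<close>, it raises it only to
  \<open>g t\<close>, so no comparison with \<open>g t\<close> changes. Whether \<open>g\<close>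
  reaches the maximum is thus decided by the other points, which makes this event independent of the
  presence of \<open>g\<close>.\<close>

lemma hits_max_at_iff:
  assumes "finite x"
  shows "hits F g (max_at (insert g x)) \<longleftrightarrow> hits F g (max_at x)"
proof -
  have "max_at (insert g x) t \<le> g t \<longleftrightarrow> max_at x t \<le> g t" if "0 < g t" for t
    using assms that by (auto simp: max_at_def)
  then show ?thesis unfolding hits_def by auto
qed

text \<open>A point that attains a positive maximum of \<open>x\<close> on \<open>F\<close> hits it
  and is kept. A point that does not hit never exceeds this maximum on \<open>F\<close>, so the
  points brought in from \<open>y\<close> cannot raise it.\<close>

lemma max_at_exchange:
  assumes "finite x" "finite y" and t: "t \<in> F"
    and H: "\<And>g. g \<in> x \<union> y \<Longrightarrow> g \<in> H \<longleftrightarrow> hits F g (max_at x)"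
  shows "max_at (x \<inter> H \<union> (y - H)) t = max_at x t"
proof (rule antisym)
  show "max_at (x \<inter> H \<union> (y - H)) t \<le> max_at x t"
  proof (rule max_at_le)
    fix g assume g: "g \<in> x \<inter> H \<union> (y - H)"
    show "g t \<le> max_at x t"
    proof (cases "g \<in> x")
      case True
      then show ?thesis by (simp add: assms max_at_upper)
    next
      case False
      then have "\<not> hits F g (max_at x)" using g H by auto
      then show ?thesis
        using t max_at_nonneg[OF assms(1), of t] unfolding hits_def by force
    qed
  qed (use assms max_at_nonneg in auto)
  show "max_at x t \<le> max_at (x \<inter> H \<union> (y - H)) t"
  proof (cases "0 < max_at x t")
    case True
    then obtain g where g: "g \<in> x" "g t = max_at x t"
      by (rule max_at_attained[OF assms(1)])
    then have "hits F g (max_at x)"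
      using t True unfolding hits_def by force
    then have "g \<in> x \<inter> H \<union> (y - H)" using g H by auto
    then show ?thesis
      using max_at_upper[of "x \<inter> H \<union> (y - H)" g t] g assms by simp
  next
    case False
    then show ?thesis
      using max_at_nonneg[of "x \<inter> H \<union> (y - H)" t] assms by simp
  qed
qed

section \<open>Random subsets of a finite set with independent memberships\<close>

lemma subset_weight_nonneg:
  "(\<And>g. g \<in> G \<Longrightarrow> 0 \<le> p g \<and> p g \<le> 1) \<Longrightarrow> 0 \<le> subset_weight G p x"
  unfolding subset_weight_def by (intro prod_nonneg) auto

lemma subset_weight_insert:
  assumes "finite G" "g \<in> G" "g \<notin> x"
  shows "subset_weight G p (insert g x) = p g * subset_weight (G - {g}) p x"
    and "subset_weight G p x = (1 - p g) * subset_weight (G - {g}) p x"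
proof -
  have "(\<Prod>h\<in>G - {g}. if h \<in> insert g x then p h else 1 - p h) =
      (\<Prod>h\<in>G - {g}. if h \<in> x then p h else 1 - p h)"
    by (intro prod.cong) auto
  then show "subset_weight G p (insert g x) = p g * subset_weight (G - {g}) p x"
    unfolding subset_weight_def using assms by (subst prod.remove[of G g]) auto
  show "subset_weight G p x = (1 - p g) * subset_weight (G - {g}) p x"
    unfolding subset_weight_def using assms by (subst prod.remove[of G g]) auto
qed

lemma sum_Pow_split:
  fixes f :: "'b set \<Rightarrow> real"
  assumes "finite G" "g \<in> G"
  shows "(\<Sum>x\<in>Pow G. f x) = (\<Sum>x\<in>Pow (G - {g}). f x) + (\<Sum>x\<in>Pow (G - {g}). f (insert g x))"
proof -
  have G: "G = insert g (G - {g})" using assms by auto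
  have "(\<Sum>x\<in>Pow G. f x) = (\<Sum>x\<in>Pow (G - {g}) \<union> insert g ` Pow (G - {g}). f x)"
    by (subst G, subst Pow_insert) simp
  also have "\<dots> = (\<Sum>x\<in>Pow (G - {g}). f x) + (\<Sum>x\<in>insert g ` Pow (G - {g}). f x)"
    using assms by (intro sum.union_disjoint) auto
  also have "(\<Sum>x\<in>insert g ` Pow (G - {g}). f x) = (\<Sum>x\<in>Pow (G - {g}). f (insert g x))"
    by (subst sum.reindex) (auto simp: inj_on_def)
  finally show ?thesis .
qed

text \<open>Splitting the subsets of \<open>G\<close> by the membership of \<open>g\<close>
  separates the factor \<open>p g\<close> or \<open>1 - p g\<close>, and the remaining sum does not
  see \<open>g\<close>. In probabilistic terms, \<open>R\<close> is independent of the event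
  \<open>g \<in> x\<close>.\<close>

lemma sum_subset_weight_indep:
  assumes "finite G" "g \<in> G"
    and R: "\<And>x. x \<subseteq> G - {g} \<Longrightarrow> R (insert g x) \<longleftrightarrow> R x"
  shows "(\<Sum>x\<in>Pow G. subset_weight G p x * of_bool (g \<in> x \<and> R x)) =
    p g * (\<Sum>x\<in>Pow G. subset_weight G p x * of_bool (R x))"
proof -
  have 1: "(\<Sum>x\<in>Pow G. subset_weight G p x * of_bool (g \<in> x \<and> R x)) =
      p g * (\<Sum>x\<in>Pow (G - {g}). subset_weight (G - {g}) p x * of_bool (R x))"
  proof -
    have "(\<Sum>x\<in>Pow (G - {g}). subset_weight G p x * of_bool (g \<in> x \<and> R x)) = 0"
      by (intro sum.neutral) auto
    moreover have "(\<Sum>x\<in>Pow (G - {g}). subset_weight G p (insert g x) *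
          of_bool (g \<in> insert g x \<and> R (insert g x))) =
        (\<Sum>x\<in>Pow (G - {g}). p g * (subset_weight (G - {g}) p x * of_bool (R x)))"
      using R assms by (intro sum.cong refl) (subst subset_weight_insert(1), auto)
    ultimately show ?thesis
      by (simp add: sum_Pow_split[OF assms(1,2)] sum_distrib_left)
  qed
  have 2: "(\<Sum>x\<in>Pow G. subset_weight G p x * of_bool (R x)) =
      (\<Sum>x\<in>Pow (G - {g}). subset_weight (G - {g}) p x * of_bool (R x))"
  proof -
    have "(\<Sum>x\<in>Pow G. subset_weight G p x * of_bool (R x)) =
      (\<Sum>x\<in>Pow (G - {g}). (1 - p g) * (subset_weight (G - {g}) p x * of_bool (R x))) +
      (\<Sum>x\<in>Pow (G - {g}). p g * (subset_weight (G - {g}) p x * of_bool (R x)))"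
      unfolding sum_Pow_split[OF assms(1,2)]
    proof (intro arg_cong2[of _ _ _ _ "(+)"] sum.cong refl)
      fix x assume x: "x \<in> Pow (G - {g})"
      then have "g \<notin> x" by auto
      note w = subset_weight_insert[OF assms(1,2) this]
      show "subset_weight G p x * of_bool (R x) =
          (1 - p g) * (subset_weight (G - {g}) p x * of_bool (R x))"
        by (simp add: w(2))
      show "subset_weight G p (insert g x) * of_bool (R (insert g x)) =
          p g * (subset_weight (G - {g}) p x * of_bool (R x))"
        using R x by (simp add: w(1))
    qed
    then show ?thesis
      by (simp only: sum_distrib_left[symmetric] distrib_right[symmetric]) simp
  qed
  show ?thesis unfolding 1 2 ..
qed

lemma sum_pair_product:
  fixes f :: "'b \<Rightarrow> real" and g :: "'c \<Rightarrow> real"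
  shows "(\<Sum>(x, y)\<in>A \<times> B. f x * g y) = sum f A * sum g B"
  by (simp add: sum_product sum.cartesian_product)

lemma sum_subset_weight: "finite G \<Longrightarrow> (\<Sum>x\<in>Pow G. subset_weight G p x) = 1"
proof (induction G rule: finite_induct)
  case empty
  then show ?case by (simp add: subset_weight_def)
next
  case (insert g G)
  have w: "subset_weight (insert g G) p (insert g x) = p g * subset_weight G p x"
    "subset_weight (insert g G) p x = (1 - p g) * subset_weight G p x" if "x \<in> Pow G" for x
  proof -
    have "g \<notin> x" using insert that by auto
    note subset_weight_insert[of "insert g G" g x p, OF _ _ this]
    moreover have "insert g G - {g} = G" using insert by auto
    ultimately show "subset_weight (insert g G) p (insert g x) = p g * subset_weight G p x"
      "subset_weight (insert g G) p x = (1 - p g) * subset_weight G p x"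
      using insert by simp_all
  qed
  have "insert g G - {g} = G" using insert by auto
  then have "(\<Sum>x\<in>Pow (insert g G). subset_weight (insert g G) p x) =
      (\<Sum>x\<in>Pow G. subset_weight (insert g G) p x) +
      (\<Sum>x\<in>Pow G. subset_weight (insert g G) p (insert g x))"
    using sum_Pow_split[of "insert g G" g "subset_weight (insert g G) p"] insert by simp
  also have "\<dots> = (\<Sum>x\<in>Pow G. (1 - p g) * subset_weight G p x) + (\<Sum>x\<in>Pow G. p g * subset_weight G p x)"
    using w by (intro arg_cong2[of _ _ _ _ "(+)"] sum.cong) auto
  finally show ?case using insert by (simp add: sum_distrib_left[symmetric])
qed

text \<open>
  The exchange of \<open>x\<close> and \<open>y\<close> off the set \<open>H x\<close> of points that hit the maximum on \<open>F1\<close> preserves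
  the weight and the maximum of \<open>x\<close> on \<open>F1\<close>. It therefore turns the independent copy \<open>y\<close> into a set
  \<open>z\<close> which differs from \<open>x\<close> only in points that hit the maximum on \<open>F1\<close>.
\<close>

lemma discrete_mixing_bound:
  fixes G :: "('a \<Rightarrow> real) set" and F1 F2 :: "'a set" and C :: "('a \<Rightarrow> real) \<Rightarrow> ('a \<Rightarrow> real) \<Rightarrow> bool"
  assumes G: "finite G" and p: "\<And>g. g \<in> G \<Longrightarrow> 0 \<le> p g \<and> p g \<le> 1"
  defines "w \<equiv> subset_weight G p"
    and "U \<equiv> \<lambda>F x. restrict (max_at x) F"
    and "R \<equiv> \<lambda>g x. hits F1 g (max_at x) \<and> hits F2 g (max_at x)"
  shows "\<bar>(\<Sum>x\<in>Pow G. w x * of_bool (C (U F1 x) (U F2 x))) -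
     (\<Sum>(x, y)\<in>Pow G \<times> Pow G. w x * w y * of_bool (C (U F1 x) (U F2 y)))\<bar>
   \<le> 2 * (\<Sum>g\<in>G. p g * (\<Sum>x\<in>Pow G. w x * of_bool (R g x)))"
proof -
  let ?X = "Pow G \<times> Pow G"
  define H where "H x = {g\<in>G. hits F1 g (max_at x)}" for x
  define a where "a x y = x \<inter> H x \<union> (y - H x)" for x y
  define z where "z x y = y \<inter> H x \<union> (x - H x)" for x y
  define T where "T = (\<lambda>(x, y). (a x y, z x y))"
  have fin: "finite x" if "x \<in> Pow G" for x using that G finite_subset by auto
  have w0: "0 \<le> w x" for x
    unfolding w_def using p by (rule subset_weight_nonneg)
  have w1: "(\<Sum>x\<in>Pow G. w x) = 1"
    unfolding w_def using G by (rule sum_subset_weight)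
  have a: "max_at (a x y) t = max_at x t" if "x \<in> Pow G" "y \<in> Pow G" "t \<in> F1" for x y t
    unfolding a_def using that fin by (intro max_at_exchange[of _ _ _ F1]) (auto simp: H_def)
  \<comment> \<open>\<open>H\<close> depends on its argument only through the maximum on
    \<open>F1\<close>, which the exchange preserves. A second exchange therefore uses the same
    hitting points, and \<open>T\<close> is an involution.\<close>
  have Ha: "H (a x y) = H x" if "x \<in> Pow G" "y \<in> Pow G" for x y
    unfolding H_def using hits_cong[of F1 "max_at (a x y)" "max_at x"] a that by auto
  have Ua: "U F1 (a x y) = U F1 x" if "x \<in> Pow G" "y \<in> Pow G" for x y
    unfolding U_def using a that by (auto simp: restrict_def)
  \<comment> \<open>Each \<open>g\<close> contributes one factor for either member of the pair, and
    the exchange at most swaps the two.\<close>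
  have ww: "w (a x y) * w (z x y) = w x * w y" for x y
    unfolding w_def subset_weight_def prod.distrib[symmetric]
    by (intro prod.cong) (auto simp: a_def z_def)
  have pairs: "(\<Sum>(x, y)\<in>?X. w x * w y * (f x * h y)) =
      (\<Sum>x\<in>Pow G. w x * f x) * (\<Sum>y\<in>Pow G. w y * h y)" for f h
    unfolding sum_pair_product[symmetric] by (simp add: mult_ac)
  \<comment> \<open>Substituting along \<open>T\<close> replaces the independent second component by
    \<open>z x y\<close> and leaves the maximum on \<open>F1\<close> alone. Only the maxima of
    \<open>x\<close> and \<open>z x y\<close> on \<open>F2\<close> remain to be compared.\<close>
  have "(\<Sum>(x, y)\<in>?X. w x * w y * of_bool (C (U F1 x) (U F2 y))) =
      (\<Sum>(x, y)\<in>?X. w x * w y * of_bool (C (U F1 x) (U F2 (z x y))))"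
  proof (rule sum.reindex_bij_witness[where i = T and j = T])
    fix q assume "q \<in> ?X"
    then obtain x y where q: "q = (x, y)" and xy: "x \<in> Pow G" "y \<in> Pow G" by blast
    have H': "H (a x y) = H x" using Ha xy by auto
    have aa: "a (a x y) (z x y) = x" "z (a x y) (z x y) = y"
      unfolding a_def[of "a x y"] z_def[of "a x y"] H' by (auto simp: a_def z_def)
    show "T (T q) = q" "T (T q) = q" using aa by (simp_all add: T_def q)
    show "T q \<in> ?X" "T q \<in> ?X" using xy unfolding T_def q a_def z_def by auto
    show "(case T q of (x, y) \<Rightarrow> w x * w y * of_bool (C (U F1 x) (U F2 (z x y)))) =
        (case q of (x, y) \<Rightarrow> w x * w y * of_bool (C (U F1 x) (U F2 y)))"
      unfolding q T_def prod.case aa ww Ua[OF xy] ..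
  qed
  note eq1 = this
  have eq2: "(\<Sum>x\<in>Pow G. w x * of_bool (C (U F1 x) (U F2 x))) =
      (\<Sum>(x, y)\<in>?X. w x * w y * of_bool (C (U F1 x) (U F2 x)))"
    using pairs[of "\<lambda>x. of_bool (C (U F1 x) (U F2 x))" "\<lambda>_. 1"] w1 by simp
  have "\<bar>(\<Sum>x\<in>Pow G. w x * of_bool (C (U F1 x) (U F2 x))) -
      (\<Sum>(x, y)\<in>?X. w x * w y * of_bool (C (U F1 x) (U F2 y)))\<bar> =
    \<bar>\<Sum>(x, y)\<in>?X. w x * w y * (of_bool (C (U F1 x) (U F2 x)) - of_bool (C (U F1 x) (U F2 (z x y))))\<bar>"
    unfolding eq1 eq2 sum_subtractf[symmetric]
    by (intro arg_cong[where f = abs] sum.cong) (auto simp: right_diff_distrib)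
  also have "\<dots> \<le> (\<Sum>(x, y)\<in>?X. w x * w y *
      (\<Sum>g\<in>G. of_bool (g \<in> x \<and> R g x) + of_bool (g \<in> y) * of_bool (R g x)))"
  proof (rule order_trans[OF sum_abs], rule sum_mono)
    fix q assume "q \<in> ?X"
    then obtain x y where q: "q = (x, y)" and xy: "x \<in> Pow G" "y \<in> Pow G" by blast
    let ?s = "\<Sum>g\<in>G. of_bool (g \<in> x \<and> R g x) + of_bool (g \<in> y) * of_bool (R g x) :: real"
    have s0: "0 \<le> ?s" by (intro sum_nonneg) auto
    have z: "finite (z x y)" "z x y \<subseteq> G" using xy fin by (auto simp: z_def)
    have s: "1 \<le> ?s" if "g \<in> x \<union> y" "R g x" for g
    proof -
      have "1 \<le> (of_bool (g \<in> x \<and> R g x) + of_bool (g \<in> y) * of_bool (R g x) :: real)"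
        using that by auto
      also have "\<dots> \<le> ?s" using xy that G by (intro member_le_sum) auto
      finally show ?thesis .
    qed
    have "\<bar>of_bool (C (U F1 x) (U F2 x)) - of_bool (C (U F1 x) (U F2 (z x y)))\<bar> \<le> ?s"
    proof (cases "U F2 x = U F2 (z x y)")
      case True
      then show ?thesis using s0 by simp
    next
      case False
      then obtain t where t: "t \<in> F2" "max_at x t \<noteq> max_at (z x y) t"
        unfolding U_def by (metis restrict_ext)
      \<comment> \<open>\<open>x\<close> and \<open>z x y\<close> agree off \<open>H x\<close>. If
        the maximum at \<open>t\<close> went up, a point attaining the new one was added from
        \<open>y\<close>; if it went down, a point attaining the old one was removed from
        \<open>x\<close>. Either point lies in \<open>H x\<close> and reaches the maximum of
        \<open>x\<close> at \<open>t\<close>.\<close>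
      have "\<exists>g\<in>x \<union> y. R g x"
      proof (cases "max_at x t < max_at (z x y) t")
        case True
        then have "0 < max_at (z x y) t" using max_at_nonneg[of x t] fin[OF xy(1)] by linarith
        then obtain g where g: "g \<in> z x y" "g t = max_at (z x y) t"
          by (rule max_at_attained[OF z(1)])
        then have "g \<notin> x" using max_at_upper[of x g t] fin[OF xy(1)] True by force
        then have "g \<in> y" "g \<in> H x" using g by (auto simp: z_def)
        moreover have "hits F2 g (max_at x)"
          unfolding hits_def using t g True \<open>0 < max_at (z x y) t\<close> by force
        ultimately show ?thesis unfolding R_def H_def by auto
      next
        case False
        then have less: "max_at (z x y) t < max_at x t" using t by simp
        then have "0 < max_at x t" using max_at_nonneg[of "z x y" t] z by linarith
        then obtain g where g: "g \<in> x" "g t = max_at x t"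
          by (rule max_at_attained[OF fin[OF xy(1)]])
        then have "g \<notin> z x y" using max_at_upper[of "z x y" g t] z less by force
        then have "g \<in> H x" using g by (auto simp: z_def)
        moreover have "hits F2 g (max_at x)"
          unfolding hits_def using t g \<open>0 < max_at x t\<close> by force
        ultimately show ?thesis using g unfolding R_def H_def by auto
      qed
      then have "1 \<le> ?s" using s by blast
      then show ?thesis by (auto split: split_of_bool)
    qed
    then show "\<bar>case q of (x, y) \<Rightarrow> w x * w y * (of_bool (C (U F1 x) (U F2 x)) - of_bool (C (U F1 x) (U F2 (z x y))))\<bar>
      \<le> (case q of (x, y) \<Rightarrow> w x * w y *
        (\<Sum>g\<in>G. of_bool (g \<in> x \<and> R g x) + of_bool (g \<in> y) * of_bool (R g x)))"
      unfolding q prod.case abs_mult abs_of_nonneg[OF w0] by (intro mult_left_mono mult_nonneg_nonneg w0)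
  qed
  also have "\<dots> = (\<Sum>g\<in>G. \<Sum>(x, y)\<in>?X. w x * w y * of_bool (g \<in> x \<and> R g x)) +
      (\<Sum>g\<in>G. \<Sum>(x, y)\<in>?X. w x * w y * (of_bool (g \<in> y) * of_bool (R g x)))"
    unfolding sum_distrib_left case_prod_beta
    by (subst sum.swap) (simp add: distrib_left sum.distrib)
  \<comment> \<open>Removed points: both conditions concern \<open>x\<close>, and they factor
    because \<open>R g\<close> ignores the presence of \<open>g\<close> itself.\<close>
  also have "(\<Sum>g\<in>G. \<Sum>(x, y)\<in>?X. w x * w y * of_bool (g \<in> x \<and> R g x)) =
      (\<Sum>g\<in>G. p g * (\<Sum>x\<in>Pow G. w x * of_bool (R g x)))"
  proof (rule sum.cong[OF refl])
    fix g assume g: "g \<in> G"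
    have "(\<Sum>(x, y)\<in>?X. w x * w y * of_bool (g \<in> x \<and> R g x)) =
        (\<Sum>x\<in>Pow G. w x * of_bool (g \<in> x \<and> R g x))"
      using pairs[of "\<lambda>x. of_bool (g \<in> x \<and> R g x)" "\<lambda>_. 1"] w1 by (simp only: mult_1_right)
    also have "\<dots> = p g * (\<Sum>x\<in>Pow G. w x * of_bool (R g x))"
      unfolding w_def
    proof (rule sum_subset_weight_indep[OF G g])
      fix x assume "x \<subseteq> G - {g}"
      then show "R g (insert g x) \<longleftrightarrow> R g x"
        unfolding R_def using hits_max_at_iff[of x _ g] G by (meson finite_Diff finite_subset)
    qed
    finally show "(\<Sum>(x, y)\<in>?X. w x * w y * of_bool (g \<in> x \<and> R g x)) =
      p g * (\<Sum>x\<in>Pow G. w x * of_bool (R g x))" .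
  qed
  \<comment> \<open>Added points: membership concerns the independent copy \<open>y\<close>, so the
    double sum is a product.\<close>
  also have "(\<Sum>g\<in>G. \<Sum>(x, y)\<in>?X. w x * w y * (of_bool (g \<in> y) * of_bool (R g x))) =
      (\<Sum>g\<in>G. p g * (\<Sum>x\<in>Pow G. w x * of_bool (R g x)))"
  proof (rule sum.cong[OF refl])
    fix g assume g: "g \<in> G"
    have "(\<Sum>(x, y)\<in>?X. w x * w y * (of_bool (g \<in> y) * of_bool (R g x))) =
        (\<Sum>x\<in>Pow G. w x * of_bool (R g x)) * (\<Sum>y\<in>Pow G. w y * of_bool (g \<in> y))"
      unfolding mult.commute[of "of_bool (g \<in> _)"] by (rule pairs)
    also have "(\<Sum>y\<in>Pow G. w y * of_bool (g \<in> y)) = p g"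
      using sum_subset_weight_indep[OF G g, of "\<lambda>_. True" p] w1 by (simp add: w_def)
    finally show "(\<Sum>(x, y)\<in>?X. w x * w y * (of_bool (g \<in> y) * of_bool (R g x))) =
      p g * (\<Sum>x\<in>Pow G. w x * of_bool (R g x))"
      by (simp only: mult.commute)
  qed
  finally show ?thesis by simp
qed

subsection \<open>Borel sets of continuous functions\<close>

lemma sets_borel_sigma: "sets (borel_sigma X) = sigma_sets (topspace X) {U. openin X U}"
  unfolding borel_sigma_def by (rule sets_measure_of) (auto dest: openin_subset)

lemma space_borel_sigma [simp]: "space (borel_sigma X) = topspace X"
  unfolding borel_sigma_def by (rule space_measure_of) (auto dest: openin_subset)

lemma borel_sigma_openin: "openin X U \<Longrightarrow> U \<in> sets (borel_sigma X)"
  unfolding sets_borel_sigma by auto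

lemma openin_eval_less:
  assumes "t \<in> S"
  shows "openin (compact_conv_topology S) {h \<in> cont_fun S. h t < d}"
  unfolding openin_compact_conv_topology
proof (intro conjI ballI)
  fix f assume "f \<in> {h \<in> cont_fun S. h t < d}"
  then have "unif_nbhd S {t} (d - f t) f \<subseteq> {h \<in> cont_fun S. h t < d}" "0 < d - f t"
    by (auto simp: unif_nbhd_def)
  then show "\<exists>K e. compact K \<and> K \<subseteq> S \<and> 0 < e \<and> unif_nbhd S K e f \<subseteq> {h \<in> cont_fun S. h t < d}"
    using assms by (intro exI[of _ "{t}"] exI[of _ "d - f t"]) auto
qed auto

lemma countable_dense_subset:
  assumes "second_countable (top_of_set (S :: 'a::metric_space set))"
  obtains D where "countable D" "D \<subseteq> S" "S \<subseteq> closure D"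
proof -
  obtain D where "countable D" "D \<subseteq> S" "top_of_set S closure_of D = S"
    using second_countable_imp_separable_space[OF assms] unfolding separable_space_def by auto
  moreover have "top_of_set S closure_of D \<subseteq> closure D"
    using closure_mono[of "S \<inter> D" D] by (auto simp: closure_of_subtopology)
  ultimately show ?thesis using that by blast
qed

text \<open>Each open set is a countable union of finite intersections of tubes, and a tube is
  determined by evaluations at countably many points; both countabilities come from second
  countability. Thresholds \<open>d > 0\<close> suffice as generators because the functions are
  nonnegative.\<close>

lemma sets_borel_sigma_compact_conv:
  fixes S :: "'a::metric_space set"
  assumes "second_countable (top_of_set S)"
  shows "sets (borel_sigma (compact_conv_topology S)) =
    sigma_sets (cont_fun S) {{h \<in> cont_fun S. d \<le> h t} | t d. t \<in> S \<and> 0 < d}"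
    (is "_ = sigma_sets _ ?E")
proof
  define N where "N = sigma (cont_fun S) ?E"
  have N: "space N = cont_fun S" "sets N = sigma_sets (cont_fun S) ?E"
    unfolding N_def by (auto intro!: space_measure_of sets_measure_of)
  have ev: "(\<lambda>h. h t) \<in> borel_measurable N" if t: "t \<in> S" for t
    unfolding borel_measurable_iff_ge
  proof
    fix a :: real
    show "{h \<in> space N. a \<le> h t} \<in> sets N"
    proof (cases "0 < a")
      case True
      then show ?thesis using t unfolding N by (intro sigma_sets.Basic) auto
    next
      case False
      then have "{h \<in> space N. a \<le> h t} = space N"
        using t unfolding N by (auto simp: cont_fun_def intro: order_trans[of _ 0])
      then show ?thesis by simp
    qed
  qed
  obtain D where D: "countable D" "D \<subseteq> S" "S \<subseteq> closure D"
    using countable_dense_subset[OF assms] .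
  obtain \<B> where B: "countable \<B>" "\<And>V. V \<in> \<B> \<Longrightarrow> openin (top_of_set S) V"
    "\<And>U x. openin (top_of_set S) U \<Longrightarrow> x \<in> U \<Longrightarrow> \<exists>V\<in>\<B>. x \<in> V \<and> V \<subseteq> U"
    using assms unfolding second_countable_def by meson
  \<comment> \<open>A tube is constrained only at countably many points, hence measurable; by continuity the
    constraint extends to all of \<open>b\<close>.\<close>
  define tube where "tube = (\<lambda>(b, p, q). {h \<in> space N. \<forall>x\<in>b \<inter> D. p \<le> h x \<and> h x \<le> q})"
  define I where "I = \<B> \<times> (\<rat> :: real set) \<times> (\<rat> :: real set)"
  define tubes where "tubes L = {h \<in> space N. \<forall>i\<in>L. h \<in> tube i}" for L
  have I: "countable I" unfolding I_def using B countable_rat by auto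
  have tube: "tube i \<in> sets N" for i
  proof -
    obtain b p q where i: "i = (b, p, q)" by (cases i)
    have "{h \<in> space N. p \<le> h x \<and> h x \<le> q} \<in> sets N" if "x \<in> b \<inter> D" for x
      using ev[of x] D that by (intro sets.sets_Collect_conj borel_measurable_le) auto
    then have "space N - (\<Union>x\<in>b \<inter> D. space N - {h \<in> space N. p \<le> h x \<and> h x \<le> q}) \<in> sets N"
      using D by (intro sets.Diff sets.top sets.countable_UN') auto
    also have "space N - (\<Union>x\<in>b \<inter> D. space N - {h \<in> space N. p \<le> h x \<and> h x \<le> q}) = tube i"
      unfolding tube_def i by auto
    finally show ?thesis .
  qed
  have tubes: "tubes L \<in> sets N" if "finite L" for L
  proof -
    have "tubes L = (\<Inter>i\<in>L. tube i) \<inter> space N" unfolding tubes_def by auto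
    then show ?thesis using that tube by (cases "L = {}") auto
  qed
  have tube_dense: "p \<le> h x \<and> h x \<le> q"
    if hb: "h \<in> tube (b, p, q)" "b \<in> \<B>" "x \<in> b" for h b p q x
  proof -
    have h: "continuous_on S h" "\<And>y. y \<in> b \<inter> D \<Longrightarrow> p \<le> h y \<and> h y \<le> q"
      using that unfolding tube_def N by (auto simp: cont_fun_def)
    obtain W where W: "open W" "b = S \<inter> W"
      using B(2)[OF hb(2)] unfolding openin_open by auto
    have x: "x \<in> closure (b \<inter> D)"
    proof -
      have "x \<in> W \<inter> closure D" using that W D by auto
      then have "x \<in> closure (W \<inter> D)" using open_Int_closure_subset[OF W(1)] by auto
      moreover have "W \<inter> D = b \<inter> D" using W D by auto
      ultimately show ?thesis by simp
    qed
    then obtain s where s: "\<And>n. s n \<in> b \<inter> D" "s \<longlonglongrightarrow> x"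
      unfolding closure_sequential by auto
    have "(\<lambda>n. h (s n)) \<longlonglongrightarrow> h x"
      using h(1) that(3) W s by (intro continuous_on_tendsto_compose[of S h]) auto
    then show ?thesis
      using h(2)[OF s(1)] LIMSEQ_le_const[of "\<lambda>n. h (s n)" "h x" p]
        LIMSEQ_le_const2[of "\<lambda>n. h (s n)" "h x" q] by blast
  qed
  have "U \<in> sets N" if U: "openin (compact_conv_topology S) U" for U
  proof -
    have "\<exists>L. finite L \<and> L \<subseteq> I \<and> f \<in> tubes L \<and> tubes L \<subseteq> U" if f: "f \<in> U" for f
    proof -
      obtain K e where K: "compact K" "K \<subseteq> S" "0 < e" "unif_nbhd S K e f \<subseteq> U"
        using U f unfolding openin_compact_conv_topology by blast
      have fS: "f \<in> cont_fun S" using U f unfolding openin_compact_conv_topology by blast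
      \<comment> \<open>Rational bounds less than \<open>e\<close> apart that \<open>f\<close> obeys
        on a basic neighbourhood of \<open>x\<close>: any other function obeying them there is
        within \<open>e\<close> of \<open>f\<close>. Compactness of \<open>K\<close> then leaves
        finitely many such tubes.\<close>
      have "\<exists>b p q. b \<in> \<B> \<and> p \<in> \<rat> \<and> q \<in> \<rat> \<and> q - p < e \<and> x \<in> b \<and> f \<in> tube (b, p, q)"
        if x: "x \<in> K" for x
      proof -
        obtain p where p: "p \<in> \<rat>" "f x - e / 2 < p" "p < f x"
          using Rats_dense_in_real[of "f x - e / 2" "f x"] K by auto
        obtain q where q: "q \<in> \<rat>" "f x < q" "q < f x + e / 2"
          using Rats_dense_in_real[of "f x" "f x + e / 2"] K by auto
        have "openin (top_of_set S) (S \<inter> f -` {p<..<q})"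
          using fS by (intro continuous_openin_preimage_gen) (auto simp: cont_fun_def)
        then obtain b where b: "b \<in> \<B>" "x \<in> b" "b \<subseteq> S \<inter> f -` {p<..<q}"
          using B(3)[of "S \<inter> f -` {p<..<q}" x] x K p q by auto
        have "f \<in> tube (b, p, q)"
          using b fS unfolding tube_def N by (force simp: less_imp_le)
        then show ?thesis using b p q by (intro exI[of _ b] exI[of _ p] exI[of _ q]) auto
      qed
      then obtain b p q where bpq: "\<And>x. x \<in> K \<Longrightarrow> b x \<in> \<B> \<and> p x \<in> \<rat> \<and> q x \<in> \<rat> \<and>
          q x - p x < e \<and> x \<in> b x \<and> f \<in> tube (b x, p x, q x)"
        by metis
      have "\<exists>W. open W \<and> b x = S \<inter> W" if "x \<in> K" for x
        using B(2)[of "b x"] bpq[OF that] unfolding openin_open by auto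
      then obtain W where W: "\<And>x. x \<in> K \<Longrightarrow> open (W x) \<and> b x = S \<inter> W x" by metis
      have cover: "open (W x)" "x \<in> W x" if "x \<in> K" for x
        using W[OF that] bpq[OF that] by auto
      obtain K' where K': "K' \<subseteq> K" "finite K'" "K \<subseteq> (\<Union>x\<in>K'. W x)"
        by (rule compactE_image[OF K(1), of K W]) (use cover in auto)
      let ?L = "(\<lambda>x. (b x, p x, q x)) ` K'"
      have "tubes ?L \<subseteq> unif_nbhd S K e f"
      proof
        fix h assume h: "h \<in> tubes ?L"
        have "\<bar>h y - f y\<bar> < e" if y: "y \<in> K" for y
        proof -
          obtain x where x: "x \<in> K'" "y \<in> W x" using K' y by auto
          then have xK: "x \<in> K" using K' by auto
          then have yb: "y \<in> b x" using W x y K by auto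
          have "h \<in> tube (b x, p x, q x)" using h x unfolding tubes_def by auto
          then show ?thesis
            using tube_dense[of h "b x" "p x" "q x" y] tube_dense[of f "b x" "p x" "q x" y]
              bpq[OF xK] yb by (auto simp: abs_if)
        qed
        then show "h \<in> unif_nbhd S K e f" using h unfolding unif_nbhd_def tubes_def N by auto
      qed
      moreover have "f \<in> tubes ?L" using bpq K' fS unfolding tubes_def N by auto
      moreover have "?L \<subseteq> I" using bpq K' unfolding I_def by auto
      ultimately show ?thesis using K' K by (intro exI[of _ ?L]) blast
    qed
    \<comment> \<open>The choice of \<open>L\<close> depends on \<open>f\<close>, of which there may
      be uncountably many, but only countably many finite sets \<open>L\<close> are
      available.\<close>
    then have "U = (\<Union>L\<in>{L. finite L \<and> L \<subseteq> I \<and> tubes L \<subseteq> U}. tubes L)" by blast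
    moreover have "\<dots> \<in> sets N"
    proof (rule sets.countable_UN')
      have "countable {L. finite L \<and> L \<subseteq> I}" using I by (rule countable_Collect_finite_subset)
      then show "countable {L. finite L \<and> L \<subseteq> I \<and> tubes L \<subseteq> U}"
        by (rule countable_subset[rotated]) auto
    qed (use tubes in auto)
    ultimately show ?thesis by simp
  qed
  then have "sigma_sets (space N) {U. openin (compact_conv_topology S) U} \<subseteq> sets N"
    by (intro sets.sigma_sets_subset) auto
  then show "sets (borel_sigma (compact_conv_topology S)) \<subseteq> sigma_sets (cont_fun S) ?E"
    by (simp only: sets_borel_sigma topspace_compact_conv_topology N)
  have "{h \<in> cont_fun S. d \<le> h t} \<in> sets (borel_sigma (compact_conv_topology S))"
    if "t \<in> S" for t d
  proof -
    have "{h \<in> cont_fun S. d \<le> h t} = space (borel_sigma (compact_conv_topology S)) - {h \<in> cont_fun S. h t < d}"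
      by auto
    also have "\<dots> \<in> sets (borel_sigma (compact_conv_topology S))"
      by (intro sets.Diff sets.top borel_sigma_openin openin_eval_less that)
    finally show ?thesis .
  qed
  then show "sigma_sets (cont_fun S) ?E \<subseteq> sets (borel_sigma (compact_conv_topology S))"
    using sets.sigma_sets_subset[of ?E "borel_sigma (compact_conv_topology S)"] by auto
qed

text \<open>The point measure is a density with respect to counting measure, whose only null set is
  the empty one. The equivalence therefore holds for arbitrary, even uncountable
  \<open>A\<close>.\<close>

lemma num_points_eq_0_iff: "num_points m A = 0 \<longleftrightarrow> (\<forall>x\<in>A. m x = 0)"
  unfolding num_points_def point_measure_def
  by (subst emeasure_density)
    (auto simp: nn_integral_0_iff_AE AE_count_space indicator_def)

section \<open>Measurability of function-valued maps and of the event that one function is not below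
  another\<close>

lemma eval_measurable_borel_sigma:
  assumes "t \<in> S"
  shows "(\<lambda>h. h t) \<in> borel_measurable (borel_sigma (compact_conv_topology S))"
  unfolding borel_measurable_iff_less
  using borel_sigma_openin[OF openin_eval_less[OF assms]] by simp

lemma restrict_cont_fun:
  "f \<in> cont_fun S \<Longrightarrow> S' \<subseteq> S \<Longrightarrow> restrict f S' \<in> cont_fun S'"
  unfolding cont_fun_def by (auto intro: continuous_on_cong[THEN iffD1] continuous_on_subset)

lemma measurable_compact_conv:
  fixes S :: "'a::metric_space set"
  assumes S: "second_countable (top_of_set S)"
    and f: "\<And>x. x \<in> space N \<Longrightarrow> f x \<in> cont_fun S"
    and ev: "\<And>t. t \<in> S \<Longrightarrow> (\<lambda>x. f x t) \<in> borel_measurable N"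
  shows "f \<in> measurable N (borel_sigma (compact_conv_topology S))"
proof (rule measurableI)
  fix A assume "A \<in> sets (borel_sigma (compact_conv_topology S))"
  then show "f -` A \<inter> space N \<in> sets N"
    unfolding sets_borel_sigma_compact_conv[OF S]
  proof (induction A rule: sigma_sets.induct)
    case (Basic A)
    then obtain t d where "t \<in> S" and A: "A = {h \<in> cont_fun S. d \<le> h t}" by auto
    then have "f -` A \<inter> space N = {x \<in> space N. d \<le> f x t}" using f by auto
    then show ?case using ev[OF \<open>t \<in> S\<close>] by simp
  next
    case (Compl A)
    have "f -` (cont_fun S - A) \<inter> space N = space N - (f -` A \<inter> space N)" using f by auto
    then show ?case using Compl by simp
  next
    case (Union A)
    have "f -` (\<Union>i. A i) \<inter> space N = (\<Union>i. f -` A i \<inter> space N)" by auto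
    also have "\<dots> \<in> sets N" using Union.IH by (intro sets.countable_UN) auto
    finally show ?case .
  qed simp
qed (use f in simp)

text \<open>Second countability selects countably many of the neighbourhoods with compact hull that
  local compactness provides, and closedness of \<open>S\<close> keeps the traces on
  \<open>S\<close> compact.\<close>

lemma compact_countable_cover:
  fixes S :: "'a::metric_space set"
  assumes "locally_compact_space (euclidean :: 'a topology)" "closed S" "second_countable (top_of_set S)"
  obtains \<K> where "countable \<K>" "\<And>K. K \<in> \<K> \<Longrightarrow> compact K \<and> K \<subseteq> S" "S = \<Union>\<K>"
proof -
  have "\<exists>U K. open U \<and> compact K \<and> x \<in> U \<and> U \<subseteq> K" for x :: 'a
    using assms(1) unfolding locally_compact_space_def by simp
  then obtain U K where UK: "\<And>x :: 'a. open (U x) \<and> compact (K x) \<and> x \<in> U x \<and> U x \<subseteq> K x"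
    by metis
  have "Lindelof_space (top_of_set S)"
    using assms(3) by (rule second_countable_imp_Lindelof_space)
  moreover have "\<forall>V\<in>(\<lambda>x. S \<inter> U x) ` S. openin (top_of_set S) V"
    using UK by auto
  moreover have "\<Union>((\<lambda>x. S \<inter> U x) ` S) = topspace (top_of_set S)"
    using UK by auto
  ultimately obtain \<V> where V: "countable \<V>" "\<V> \<subseteq> (\<lambda>x. S \<inter> U x) ` S" "\<Union>\<V> = S"
    unfolding Lindelof_space_def by (metis topspace_euclidean_subtopology)
  obtain X where X: "countable X" "X \<subseteq> S" "\<V> = (\<lambda>x. S \<inter> U x) ` X"
    using V(1,2) countable_subset_image[of \<V> "\<lambda>x. S \<inter> U x" S] by blast
  show ?thesis
  proof
    show "countable ((\<lambda>x. S \<inter> K x) ` X)" using X by auto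
    show "compact C \<and> C \<subseteq> S" if C_in: "C \<in> (\<lambda>x. S \<inter> K x) ` X" for C
    proof -
      obtain x where C: "C = S \<inter> K x" using C_in by auto
      have "compact (K x)" using UK[of x] by simp
      then show ?thesis unfolding C using closed_Int_compact[OF assms(2)] by simp
    qed
    show "S = \<Union>((\<lambda>x. S \<inter> K x) ` X)"
    proof (intro equalityI subsetI)
      fix s assume s: "s \<in> S"
      then have "s \<in> \<Union>\<V>" using V(3) by simp
      then obtain x where "x \<in> X" "s \<in> U x" unfolding X(3) by auto
      then show "s \<in> \<Union>((\<lambda>x. S \<inter> K x) ` X)" using s UK[of x] by auto
    qed auto
  qed
qed

text \<open>The event says that the infimum of \<open>g x - f\<close> over \<open>K\<close> is at
  most 0, since compactness makes the infimum attained. A point with \<open>g x t \<le> f t\<close>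
  need not lie in the countable dense set, hence the slack \<open>1 / real (Suc n)\<close>.\<close>

lemma not_less_on_compact_measurable:
  fixes S K :: "'a::metric_space set"
  assumes S: "second_countable (top_of_set S)" and K: "compact K" "K \<subseteq> S"
    and f: "continuous_on K f"
    and g: "\<And>x. x \<in> space N \<Longrightarrow> continuous_on K (g x)"
    and ev: "\<And>t. t \<in> S \<Longrightarrow> (\<lambda>x. g x t) \<in> borel_measurable N"
  shows "{x \<in> space N. not_less_on K f (g x)} \<in> sets N"
proof -
  have "second_countable (subtopology (top_of_set S) K)"
    using S by (rule second_countable_subtopology)
  then obtain D where D: "countable D" "D \<subseteq> K" "K \<subseteq> closure D"
    using countable_dense_subset[of K] K(2) by (auto simp: subtopology_subtopology inf.absorb2)
  have "not_less_on K f (g x) \<longleftrightarrow> (\<forall>n. \<exists>t\<in>D. g x t < f t + 1 / real (Suc n))" if x: "x \<in> space N" for x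
  proof
    assume "not_less_on K f (g x)"
    then obtain s where s: "s \<in> K" "g x s \<le> f s" unfolding not_less_on_def by auto
    show "\<forall>n. \<exists>t\<in>D. g x t < f t + 1 / real (Suc n)"
    proof
      fix n
      have "s \<in> closure D" using D s by blast
      then obtain u where u: "\<And>i. u i \<in> D" "u \<longlonglongrightarrow> s"
        unfolding closure_sequential by auto
      have uK: "u i \<in> K" for i using u(1)[of i] D(2) by (rule subsetD[rotated])
      then have ev_uK: "\<forall>\<^sub>F i in sequentially. u i \<in> K" by simp
      have "(\<lambda>i. f (u i)) \<longlonglongrightarrow> f s"
        using f u(2) s(1) ev_uK by (rule continuous_on_tendsto_compose)
      moreover have "(\<lambda>i. g x (u i)) \<longlonglongrightarrow> g x s"
        using g[OF x] u(2) s(1) ev_uK by (rule continuous_on_tendsto_compose)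
      ultimately have lim: "(\<lambda>i. g x (u i) - f (u i)) \<longlonglongrightarrow> g x s - f s"
        by (intro tendsto_diff)
      have "0 < 1 / real (Suc n)" by simp
      then have "g x s - f s < 1 / real (Suc n)" using s by linarith
      then have "eventually (\<lambda>i. g x (u i) - f (u i) < 1 / real (Suc n)) sequentially"
        by (rule order_tendstoD(2)[OF lim])
      then obtain i where "g x (u i) - f (u i) < 1 / real (Suc n)"
        using eventually_happens'[OF sequentially_bot] by blast
      then show "\<exists>t\<in>D. g x t < f t + 1 / real (Suc n)"
        using u(1)[of i] by (intro bexI[of _ "u i"]) auto
    qed
  next
    assume *: "\<forall>n. \<exists>t\<in>D. g x t < f t + 1 / real (Suc n)"
    then have "K \<noteq> {}" using D by auto
    then obtain s where s: "s \<in> K" "\<And>t. t \<in> K \<Longrightarrow> g x s - f s \<le> g x t - f t"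
      using continuous_attains_inf[of K "\<lambda>t. g x t - f t"] K f g[OF x]
      by (auto intro: continuous_on_diff)
    have "g x s - f s \<le> 0 + e" if "0 < e" for e
    proof -
      obtain n where n: "1 / real (Suc n) < e" using \<open>0 < e\<close> nat_approx_posE by blast
      obtain t where "t \<in> D" "g x t < f t + 1 / real (Suc n)" using * by blast
      then show ?thesis using s(2)[of t] D n by auto
    qed
    then have "g x s - f s \<le> 0" by (rule field_le_epsilon)
    then show "not_less_on K f (g x)" using s unfolding not_less_on_def by auto
  qed
  then have "{x \<in> space N. not_less_on K f (g x)} =
      {x \<in> space N. \<forall>n. x \<in> (\<Union>t\<in>D. {x \<in> space N. g x t < f t + 1 / real (Suc n)})}"
    by auto
  also have "\<dots> \<in> sets N"
  proof (rule sets.sets_Collect_countable_All)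
    fix n
    let ?A = "\<Union>t\<in>D. {x \<in> space N. g x t < f t + 1 / real (Suc n)}"
    have "?A \<in> sets N"
    proof (rule sets.countable_UN'[OF D(1)], rule image_subsetI)
      fix t assume "t \<in> D"
      then have "(\<lambda>x. g x t) \<in> borel_measurable N" using D(2) K(2) ev by blast
      then show "{x \<in> space N. g x t < f t + 1 / real (Suc n)} \<in> sets N" by simp
    qed
    moreover have "{x \<in> space N. x \<in> ?A} = ?A" by blast
    ultimately show "{x \<in> space N. x \<in> ?A} \<in> sets N" by simp
  qed
  finally show ?thesis .
qed

subsection \<open>Max-infinitely divisible processes\<close>

locale max_id = prob_space M
  for M :: "'w measure" and \<mu> :: "('a::metric_space \<Rightarrow> real) measure"
    and \<Phi> :: "'w \<Rightarrow> ('a \<Rightarrow> real) \<Rightarrow> nat" and \<eta> :: "'w \<Rightarrow> 'a \<Rightarrow> real" +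
  assumes max_id_process: "max_id_process M \<mu> \<Phi> \<eta>"
begin

lemma space_exponent: "space \<mu> = cont_fun UNIV - {\<lambda>_. 0}"
  using max_id_process unfolding max_id_process_def exponent_measure_def
  by (auto simp: nonzero_topology_def)

lemma eval_measurable_exponent [measurable]: "(\<lambda>f. f t) \<in> borel_measurable \<mu>"
  unfolding borel_measurable_iff_less
proof
  fix d
  have "openin nonzero_topology ({h \<in> cont_fun UNIV. h t < d} \<inter> (cont_fun UNIV - {\<lambda>_. 0}))"
    unfolding nonzero_topology_def openin_subtopology
    using openin_eval_less[of t UNIV d] by auto
  also have "{h \<in> cont_fun UNIV. h t < d} \<inter> (cont_fun UNIV - {\<lambda>_. 0}) = {f \<in> space \<mu>. f t < d}"
    unfolding space_exponent by auto
  finally show "{f \<in> space \<mu>. f t < d} \<in> sets \<mu>"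
    using borel_sigma_openin max_id_process
    unfolding max_id_process_def exponent_measure_def by auto
qed

lemma exponent_finite:
  assumes "0 < d"
  shows "emeasure \<mu> {f \<in> space \<mu>. d \<le> f t} < \<infinity>"
proof -
  \<comment> \<open>The compact set is a single point, and halving \<open>d\<close> turns the weak
    inequality into the strict one of \<open>exponent_measure\<close>.\<close>
  have "emeasure \<mu> {f \<in> space \<mu>. d / 2 < (SUP t\<in>{t}. f t)} < \<infinity>"
    using max_id_process assms unfolding max_id_process_def exponent_measure_def
    by (elim conjE allE[of _ "{t}"] allE[of _ "d / 2"]) auto
  moreover have "emeasure \<mu> {f \<in> space \<mu>. d \<le> f t} \<le> emeasure \<mu> {f \<in> space \<mu>. d / 2 < (SUP t\<in>{t}. f t)}"
    using assms by (intro emeasure_mono) auto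
  ultimately show ?thesis by (rule order.strict_trans1[rotated])
qed

lemma point_in_space: "\<omega> \<in> space M \<Longrightarrow> 0 < \<Phi> \<omega> f \<Longrightarrow> f \<in> space \<mu>"
  using max_id_process unfolding max_id_process_def poisson_point_process_def by blast

lemma num_points_measurable: "A \<in> sets \<mu> \<Longrightarrow> (\<lambda>\<omega>. num_points (\<Phi> \<omega>) A) \<in> borel_measurable M"
  using max_id_process unfolding max_id_process_def poisson_point_process_def by blast

lemma prob_no_points:
  assumes "A \<in> sets \<mu>" "emeasure \<mu> A < \<infinity>"
  shows "prob {\<omega> \<in> space M. num_points (\<Phi> \<omega>) A = 0} = exp (- measure \<mu> A)"
proof -
  have "\<forall>k::nat. prob {\<omega> \<in> space M. num_points (\<Phi> \<omega>) A = of_nat k} =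
      measure \<mu> A ^ k / fact k * exp (- measure \<mu> A)"
    using max_id_process assms unfolding max_id_process_def poisson_point_process_def by blast
  from this[rule_format, of 0] show ?thesis by simp
qed

lemma num_points_indep:
  "(\<And>i. i < n \<Longrightarrow> A i \<in> sets \<mu>) \<Longrightarrow> disjoint_family_on A {..<n} \<Longrightarrow>
    indep_vars (\<lambda>_. borel) (\<lambda>i \<omega>. num_points (\<Phi> \<omega>) (A i)) {..<(n::nat)}"
  using max_id_process unfolding max_id_process_def poisson_point_process_def by blast

lemma \<eta>_cont: "\<omega> \<in> space M \<Longrightarrow> \<eta> \<omega> \<in> cont_fun UNIV"
  using max_id_process unfolding max_id_process_def max_process_def by blast

lemma \<eta>_spec:
  assumes "\<omega> \<in> space M"
  shows "if {f t | f. 0 < \<Phi> \<omega> f} = {} then \<eta> \<omega> t = 0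
    else \<eta> \<omega> t \<in> {f t | f. 0 < \<Phi> \<omega> f} \<and> (\<forall>v\<in>{f t | f. 0 < \<Phi> \<omega> f}. v \<le> \<eta> \<omega> t)"
  using max_id_process assms unfolding max_id_process_def max_process_def Let_def by blast

lemma point_le_\<eta>: "\<omega> \<in> space M \<Longrightarrow> 0 < \<Phi> \<omega> f \<Longrightarrow> f t \<le> \<eta> \<omega> t"
  using \<eta>_spec[of \<omega> t] by (auto split: if_splits)

lemma \<eta>_attained:
  assumes "\<omega> \<in> space M" "0 < \<eta> \<omega> t"
  obtains f where "0 < \<Phi> \<omega> f" "f t = \<eta> \<omega> t"
proof -
  have "\<eta> \<omega> t \<in> {f t | f. 0 < \<Phi> \<omega> f}"
    using \<eta>_spec[OF assms(1), of t] assms(2) by (metis less_irrefl)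
  then show ?thesis using that by auto
qed

text \<open>Since the maximum is attained when positive, \<open>d \<le> \<eta> \<omega> t\<close>
  with \<open>d > 0\<close> means that some point of the configuration lies in
  \<open>{f. d \<le> f t}\<close>, an event about a point count.\<close>

lemma \<eta>_measurable [measurable]: "(\<lambda>\<omega>. \<eta> \<omega> t) \<in> borel_measurable M"
  unfolding borel_measurable_iff_ge
proof
  fix d
  show "{\<omega> \<in> space M. d \<le> \<eta> \<omega> t} \<in> sets M"
  proof (cases "0 < d")
    case True
    have "d \<le> \<eta> \<omega> t \<longleftrightarrow> num_points (\<Phi> \<omega>) {f \<in> space \<mu>. d \<le> f t} \<noteq> 0" if \<omega>: "\<omega> \<in> space M" for \<omega>
      unfolding num_points_eq_0_iff
    proof
      assume d: "d \<le> \<eta> \<omega> t"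
      then have "0 < \<eta> \<omega> t" using True by linarith
      then obtain f where f: "0 < \<Phi> \<omega> f" "f t = \<eta> \<omega> t"
        by (rule \<eta>_attained[OF \<omega>])
      then have "f \<in> {f \<in> space \<mu>. d \<le> f t}" using point_in_space[OF \<omega> f(1)] d by simp
      then show "\<not> (\<forall>f\<in>{f \<in> space \<mu>. d \<le> f t}. \<Phi> \<omega> f = 0)"
        using f(1) by (metis less_irrefl)
    next
      assume "\<not> (\<forall>f\<in>{f \<in> space \<mu>. d \<le> f t}. \<Phi> \<omega> f = 0)"
      then obtain f where "d \<le> f t" "0 < \<Phi> \<omega> f" by auto
      then show "d \<le> \<eta> \<omega> t" using point_le_\<eta>[OF \<omega>, of f t] by linarith
    qed
    then have "{\<omega> \<in> space M. d \<le> \<eta> \<omega> t} =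
        {\<omega> \<in> space M. num_points (\<Phi> \<omega>) {f \<in> space \<mu>. d \<le> f t} \<noteq> 0}" by auto
    moreover have "(\<lambda>\<omega>. num_points (\<Phi> \<omega>) {f \<in> space \<mu>. d \<le> f t}) \<in> borel_measurable M"
      by (intro num_points_measurable) measurable
    ultimately show ?thesis by simp
  next
    case False
    have "d \<le> \<eta> \<omega> t" if "\<omega> \<in> space M" for \<omega>
    proof -
      have "0 \<le> \<eta> \<omega> t" using \<eta>_cont[OF that] by (simp add: cont_fun_def)
      then show ?thesis using False by linarith
    qed
    then have "{\<omega> \<in> space M. d \<le> \<eta> \<omega> t} = space M" by blast
    then show ?thesis by simp
  qed
qed

lemma restrict_\<eta>_measurable:
  assumes "second_countable (top_of_set S)"
  shows "(\<lambda>\<omega>. restrict (\<eta> \<omega>) S) \<in> measurable M (borel_sigma (compact_conv_topology S))"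
proof (rule measurable_compact_conv[OF assms])
  show "restrict (\<eta> \<omega>) S \<in> cont_fun S" if "\<omega> \<in> space M" for \<omega>
    using restrict_cont_fun[OF \<eta>_cont[OF that], of S] by simp
qed simp

text \<open>On \<open>S\<close> itself the infimum of the difference need not be attained; on each
  of countably many compact pieces it is.\<close>

lemma not_less_on_\<eta>_measurable:
  assumes "locally_compact_space (euclidean :: 'a topology)" "closed S" "second_countable (top_of_set S)"
    and f: "f \<in> cont_fun UNIV"
  shows "{\<omega> \<in> space M. not_less_on S f (\<eta> \<omega>)} \<in> sets M"
proof -
  obtain \<K> where K: "countable \<K>" "\<And>K. K \<in> \<K> \<Longrightarrow> compact K \<and> K \<subseteq> S" "S = \<Union>\<K>"
    using compact_countable_cover[OF assms(1-3)] by metis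
  have "{\<omega> \<in> space M. not_less_on K f (\<eta> \<omega>)} \<in> sets M" if "K \<in> \<K>" for K
  proof (rule not_less_on_compact_measurable[OF assms(3)])
    show "continuous_on K f"
      using f by (auto simp: cont_fun_def intro: continuous_on_subset)
    show "continuous_on K (\<eta> \<omega>)" if "\<omega> \<in> space M" for \<omega>
      using \<eta>_cont[OF that] by (auto simp: cont_fun_def intro: continuous_on_subset)
  qed (use K(2)[OF that] in auto)
  moreover have "{\<omega> \<in> space M. not_less_on S f (\<eta> \<omega>)} = (\<Union>K\<in>\<K>. {\<omega> \<in> space M. not_less_on K f (\<eta> \<omega>)})"
    unfolding not_less_on_def K(3) by auto
  ultimately show ?thesis using K(1) by auto
qed

end

subsection \<open>Discretisation\<close>

definition round_down :: "real set \<Rightarrow> real \<Rightarrow> real" where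
  "round_down Q x = Max (insert 0 {d \<in> Q. d \<le> x})"

lemma round_down_in: "finite Q \<Longrightarrow> round_down Q x \<in> insert 0 {d \<in> Q. d \<le> x}"
  unfolding round_down_def by (intro Max_in) auto

lemma round_down_nonneg: "finite Q \<Longrightarrow> 0 \<le> round_down Q x"
  unfolding round_down_def by simp

text \<open>Comparisons with a threshold survive rounding, so an event built from such comparisons
  can be read off the rounded values.\<close>

lemma le_round_down_iff:
  assumes "finite Q" "d \<in> Q" "0 < d"
  shows "d \<le> round_down Q x \<longleftrightarrow> d \<le> x"
proof
  assume "d \<le> round_down Q x"
  then show "d \<le> x" using round_down_in[of Q x] assms by auto
next
  assume "d \<le> x"
  then show "d \<le> round_down Q x" unfolding round_down_def using assms by (intro Max_ge) auto
qed

lemma round_down_mono: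
  assumes "finite Q" "\<And>d. d \<in> Q \<Longrightarrow> d \<le> x \<Longrightarrow> d \<le> y"
  shows "round_down Q x \<le> round_down Q y"
  unfolding round_down_def using assms by (intro Max_mono) auto

lemma round_down_pos_iff:
  assumes "finite Q" "Q \<subseteq> {0<..}"
  shows "0 < round_down Q x \<longleftrightarrow> (\<exists>d\<in>Q. d \<le> x)"
proof
  assume "0 < round_down Q x"
  then show "\<exists>d\<in>Q. d \<le> x" using round_down_in[OF assms(1), of x] by auto
next
  assume "\<exists>d\<in>Q. d \<le> x"
  then obtain d where "d \<in> Q" "d \<le> x" by blast
  moreover from this have "0 < d" using assms(2) by auto
  ultimately show "0 < round_down Q x"
    using le_round_down_iff[of Q d x] assms(1) by simp
qed

lemma round_down_measurable [measurable]:
  assumes "finite Q"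
  shows "round_down Q \<in> borel_measurable borel"
proof (rule borel_measurable_mono)
  show "mono (round_down Q)"
    using round_down_mono[OF assms] by (auto intro!: monoI)
qed

section \<open>Random elements with finitely many values\<close>

lemma (in prob_space) prob_finite_range:
  assumes "finite I" "\<And>\<omega>. \<omega> \<in> space M \<Longrightarrow> X \<omega> \<in> I"
    and "\<And>x. x \<in> I \<Longrightarrow> {\<omega> \<in> space M. X \<omega> = x} \<in> events"
  shows "prob {\<omega> \<in> space M. \<phi> (X \<omega>)} = (\<Sum>x\<in>I. prob {\<omega> \<in> space M. X \<omega> = x} * of_bool (\<phi> x))"
proof -
  let ?J = "{x \<in> I. \<phi> x}"
  have eq: "{\<omega> \<in> space M. \<phi> (X \<omega>)} = (\<Union>x\<in>?J. {\<omega> \<in> space M. X \<omega> = x})"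
    using assms(2) by auto
  have "prob {\<omega> \<in> space M. \<phi> (X \<omega>)} = (\<Sum>x\<in>?J. prob {\<omega> \<in> space M. X \<omega> = x})"
    unfolding eq using assms
    by (intro finite_measure_finite_Union) (auto simp: disjoint_family_on_def)
  also have "\<dots> = (\<Sum>x\<in>I. prob {\<omega> \<in> space M. X \<omega> = x} * of_bool (\<phi> x))"
    using assms(1) by (intro sum.mono_neutral_cong_left) auto
  finally show "prob {\<omega> \<in> space M. \<phi> (X \<omega>)} =
    (\<Sum>x\<in>I. prob {\<omega> \<in> space M. X \<omega> = x} * of_bool (\<phi> x))" .
qed

lemma (in prob_space) prob_finite_range_pair:
  assumes "finite I" "\<And>\<omega>. \<omega> \<in> space M \<Longrightarrow> X \<omega> \<in> I"
    and ev: "\<And>x. x \<in> I \<Longrightarrow> {\<omega> \<in> space M. X \<omega> = x} \<in> events"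
  shows "measure (M \<Otimes>\<^sub>M M) {q \<in> space (M \<Otimes>\<^sub>M M). \<phi> (X (fst q)) (X (snd q))} =
    (\<Sum>(x, y)\<in>I \<times> I. prob {\<omega> \<in> space M. X \<omega> = x} * prob {\<omega> \<in> space M. X \<omega> = y} * of_bool (\<phi> x y))"
proof -
  interpret PP: pair_prob_space M M by unfold_locales
  let ?Z = "\<lambda>q. (X (fst q), X (snd q))"
  have eq: "{q \<in> space (M \<Otimes>\<^sub>M M). ?Z q = (x, y)} =
      {\<omega> \<in> space M. X \<omega> = x} \<times> {\<omega> \<in> space M. X \<omega> = y}" for x y
    by (auto simp: space_pair_measure)
  have "measure (M \<Otimes>\<^sub>M M) {q \<in> space (M \<Otimes>\<^sub>M M). case_prod \<phi> (?Z q)} =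
      (\<Sum>z\<in>I \<times> I. measure (M \<Otimes>\<^sub>M M) {q \<in> space (M \<Otimes>\<^sub>M M). ?Z q = z} * of_bool (case_prod \<phi> z))"
  proof (rule PP.P.prob_finite_range)
    show "finite (I \<times> I)" using assms(1) by simp
    show "?Z q \<in> I \<times> I" if "q \<in> space (M \<Otimes>\<^sub>M M)" for q
      using that assms(2) by (auto simp: space_pair_measure)
    show "{q \<in> space (M \<Otimes>\<^sub>M M). ?Z q = z} \<in> sets (M \<Otimes>\<^sub>M M)" if "z \<in> I \<times> I" for z
      using that ev by (cases z) (simp only: eq, auto)
  qed
  also have "\<dots> = (\<Sum>(x, y)\<in>I \<times> I. prob {\<omega> \<in> space M. X \<omega> = x} *
      prob {\<omega> \<in> space M. X \<omega> = y} * of_bool (\<phi> x y))"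
  proof (rule sum.cong[OF refl])
    fix z assume "z \<in> I \<times> I"
    then obtain x y where z: "z = (x, y)" and "x \<in> I" "y \<in> I" by blast
    then show "measure (M \<Otimes>\<^sub>M M) {q \<in> space (M \<Otimes>\<^sub>M M). ?Z q = z} * of_bool (case_prod \<phi> z) =
      (case z of (x, y) \<Rightarrow> prob {\<omega> \<in> space M. X \<omega> = x} * prob {\<omega> \<in> space M. X \<omega> = y} * of_bool (\<phi> x y))"
      unfolding z eq prod.case using emeasure_pair_measure_Times[OF ev ev, of x y]
      by (simp add: measure_def enn2real_mult)
  qed
  finally show ?thesis by simp
qed

section \<open>The mixing bound for finitely many points and thresholds\<close>

context max_id
begin

text \<open>The discretised counterpart of the integrand in the final bound: finite sets replace the
  closed ones, and both functions are rounded down.\<close>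

definition both_hit_prob :: "'a set \<Rightarrow> 'a set \<Rightarrow> real set \<Rightarrow> ('a \<Rightarrow> real) \<Rightarrow> ennreal" where
  "both_hit_prob F1 F2 Q f = emeasure M {\<omega> \<in> space M.
     hits F1 (\<lambda>t. round_down Q (f t)) (\<lambda>t. round_down Q (\<eta> \<omega> t)) \<and>
     hits F2 (\<lambda>t. round_down Q (f t)) (\<lambda>t. round_down Q (\<eta> \<omega> t))}"

lemma hits_measurable [measurable]:
  assumes [measurable]: "finite F" "finite Q"
  shows "Measurable.pred (\<mu> \<Otimes>\<^sub>M M)
    (\<lambda>x. hits F (\<lambda>t. round_down Q (fst x t)) (\<lambda>t. round_down Q (\<eta> (snd x) t)))"
  unfolding hits_def by measurable

lemma both_hit_prob_measurable [measurable]: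
  assumes "finite F1" "finite F2" "finite Q"
  shows "both_hit_prob F1 F2 Q \<in> borel_measurable \<mu>"
  unfolding both_hit_prob_def
proof (rule measurable_emeasure)
  show "{x \<in> space (\<mu> \<Otimes>\<^sub>M M). snd x \<in> {\<omega> \<in> space M.
      hits F1 (\<lambda>t. round_down Q (fst x t)) (\<lambda>t. round_down Q (\<eta> \<omega> t)) \<and>
      hits F2 (\<lambda>t. round_down Q (fst x t)) (\<lambda>t. round_down Q (\<eta> \<omega> t))}} \<in> sets (\<mu> \<Otimes>\<^sub>M M)"
    using hits_measurable[OF assms(1,3)] hits_measurable[OF assms(2,3)]
    by (simp add: space_pair_measure cong: conj_cong)
qed auto

text \<open>A function that hits must reach one of finitely many positive thresholds at one of
  finitely many points, so the integrand vanishes off a set of finite exponent measure. This permits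
  monotone convergence from above.\<close>

lemma nn_integral_both_hit_prob_finite:
  assumes F: "finite F1" "finite F2" and Q: "finite Q" "Q \<subseteq> {0<..}"
  shows "(\<integral>\<^sup>+ f. both_hit_prob F1 F2 Q f \<partial>\<mu>) < \<infinity>"
proof -
  let ?B = "\<Union>(t, d)\<in>F1 \<times> Q. {f \<in> space \<mu>. d \<le> f t}"
  have meas: "?B \<in> sets \<mu>" using F Q by (intro sets.finite_UN) auto
  have "(\<integral>\<^sup>+ f. both_hit_prob F1 F2 Q f \<partial>\<mu>) \<le> (\<integral>\<^sup>+ f. indicator ?B f \<partial>\<mu>)"
  proof (rule nn_integral_mono)
    fix f assume f: "f \<in> space \<mu>"
    show "both_hit_prob F1 F2 Q f \<le> indicator ?B f"
    proof (cases "f \<in> ?B")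
      case True
      then show ?thesis unfolding both_hit_prob_def by (simp add: emeasure_le_1)
    next
      case False
      then have "\<not> hits F1 (\<lambda>t. round_down Q (f t)) u" for u
        unfolding hits_def round_down_pos_iff[OF Q] using f by auto
      then show ?thesis unfolding both_hit_prob_def by simp
    qed
  qed
  also have "\<dots> = emeasure \<mu> ?B" using meas by simp
  also have "\<dots> \<le> (\<Sum>i\<in>F1 \<times> Q. emeasure \<mu> (case i of (t, d) \<Rightarrow> {f \<in> space \<mu>. d \<le> f t}))"
    using F Q by (intro emeasure_subadditive_finite) auto
  also have "\<dots> < \<infinity>"
    using F Q exponent_finite by (auto simp: ennreal_sum_less_top)
  finally show ?thesis .
qed

text \<open>The sets \<open>A g\<close> of functions of a given type are disjoint, so by the Poisson
  property the types occur independently and the random set \<open>X\<close> of occurring types has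
  law \<open>subset_weight\<close>. \<open>C\<close> may be any predicate because the rounded
  restrictions have finite range.\<close>

lemma finite_dim_mixing_bound:
  fixes C :: "('a \<Rightarrow> real) \<Rightarrow> ('a \<Rightarrow> real) \<Rightarrow> bool"
  assumes F: "finite F1" "finite F2" and Q: "finite Q" "Q \<subseteq> {0<..}"
  defines "V \<equiv> \<lambda>F \<omega>. restrict (\<lambda>t. round_down Q (\<eta> \<omega> t)) F"
  shows "ennreal \<bar>prob {\<omega> \<in> space M. C (V F1 \<omega>) (V F2 \<omega>)} -
      measure (M \<Otimes>\<^sub>M M) {q \<in> space (M \<Otimes>\<^sub>M M). C (V F1 (fst q)) (V F2 (snd q))}\<bar>
    \<le> 2 * (\<integral>\<^sup>+ f. both_hit_prob F1 F2 Q f \<partial>\<mu>)"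
proof -
  define F where "F = F1 \<union> F2"
  have finF: "finite F" unfolding F_def using F by simp
  \<comment> \<open>The zero type is left out: it never affects the maximum, and its functions may
    have infinite exponent measure.\<close>
  define G where "G = {g \<in> F \<rightarrow>\<^sub>E insert 0 Q. \<exists>t\<in>F. 0 < g t}"
  define A where "A g = {f \<in> space \<mu>. \<forall>t\<in>F. round_down Q (f t) = g t}" for g
  define X where "X \<omega> = {g \<in> G. num_points (\<Phi> \<omega>) (A g) \<noteq> 0}" for \<omega>
  define p where "p g = 1 - exp (- measure \<mu> (A g))" for g
  have finG: "finite G"
    unfolding G_def using finF Q by (intro finite_subset[OF _ finite_PiE[of F "\<lambda>_. insert 0 Q"]]) auto
  have A [measurable]: "A g \<in> sets \<mu>" for g
    unfolding A_def using finF Q(1) by measurable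
  have A_fin: "emeasure \<mu> (A g) < \<infinity>" if g: "g \<in> G" for g
  proof -
    obtain t where t: "t \<in> F" "0 < g t" using g unfolding G_def by auto
    have "g t \<le> f t" if "f \<in> A g" for f
    proof -
      have "round_down Q (f t) = g t" using that t unfolding A_def by auto
      then show ?thesis using round_down_in[OF Q(1), of "f t"] t by auto
    qed
    then have "A g \<subseteq> {f \<in> space \<mu>. g t \<le> f t}" unfolding A_def by auto
    then have "emeasure \<mu> (A g) \<le> emeasure \<mu> {f \<in> space \<mu>. g t \<le> f t}"
      by (intro emeasure_mono) auto
    then show ?thesis using exponent_finite[OF t(2)] by (rule order.strict_trans1)
  qed
  have ev: "{\<omega> \<in> space M. X \<omega> = x} \<in> events \<and> prob {\<omega> \<in> space M. X \<omega> = x} = subset_weight G p x"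
    if x: "x \<in> Pow G" for x
  proof (cases "G = {}")
    \<comment> \<open>Treated apart because an intersection over an empty index set would not be
      \<open>space M\<close>.\<close>
    case True
    then have "{\<omega> \<in> space M. X \<omega> = x} = space M" using x unfolding X_def by auto
    then show ?thesis using True by (simp add: subset_weight_def prob_space)
  next
    case False
    \<comment> \<open>The Poisson property states independence for sets indexed by an initial
      segment of the naturals, so the types are enumerated.\<close>
    obtain e where e: "bij_betw e {..<card G} G"
      using ex_bij_betw_nat_finite[OF finG] atLeast0LessThan by metis
    define B where "B i = (if e i \<in> x then - {0} else {0 :: ennreal})" for i
    let ?N = "\<lambda>i \<omega>. num_points (\<Phi> \<omega>) (A (e i))"
    have eG: "e i \<in> G" if "i < card G" for i using e that by (auto simp: bij_betw_def)
    have N: "?N i \<in> borel_measurable M" for i by (intro num_points_measurable A)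
    have N_zero: "prob (?N i -` {0} \<inter> space M) = 1 - p (e i)" if "i < card G" for i
    proof -
      have "?N i -` {0} \<inter> space M = {\<omega> \<in> space M. num_points (\<Phi> \<omega>) (A (e i)) = 0}" by auto
      then show ?thesis using prob_no_points[OF A A_fin[OF eG[OF that]]] by (simp add: p_def)
    qed
    have N_nonzero: "prob (?N i -` (- {0}) \<inter> space M) = p (e i)" if "i < card G" for i
    proof -
      have "?N i -` (- {0}) \<inter> space M = space M - (?N i -` {0} \<inter> space M)" by auto
      then show ?thesis
        using prob_compl[OF measurable_sets[OF N, of "{0}" i]] N_zero[OF that] by simp
    qed
    have eq: "{\<omega> \<in> space M. X \<omega> = x} = (\<Inter>i\<in>{..<card G}. ?N i -` B i \<inter> space M)"
    proof (intro equalityI subsetI)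
      fix \<omega> assume "\<omega> \<in> {\<omega> \<in> space M. X \<omega> = x}"
      then show "\<omega> \<in> (\<Inter>i\<in>{..<card G}. ?N i -` B i \<inter> space M)"
        using eG by (auto simp: X_def B_def)
    next
      fix \<omega> assume \<omega>: "\<omega> \<in> (\<Inter>i\<in>{..<card G}. ?N i -` B i \<inter> space M)"
      have "card G > 0" using False finG by (simp add: card_gt_0_iff)
      then have "\<omega> \<in> ?N 0 -` B 0 \<inter> space M" using \<omega> by (intro INT_D[OF \<omega>]) simp
      then have "\<omega> \<in> space M" by simp
      moreover have "num_points (\<Phi> \<omega>) (A g) \<noteq> 0 \<longleftrightarrow> g \<in> x" if "g \<in> G" for g
      proof -
        have "g \<in> e ` {..<card G}" using e that by (simp add: bij_betw_def)
        then obtain i where i: "i < card G" "g = e i" by auto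
        then have "\<omega> \<in> ?N i -` B i \<inter> space M" by (intro INT_D[OF \<omega>]) simp
        then show ?thesis using i(2) by (auto simp: B_def split: if_splits)
      qed
      ultimately show "\<omega> \<in> {\<omega> \<in> space M. X \<omega> = x}"
        using x unfolding X_def by auto
    qed
    have disj: "disjoint_family_on (\<lambda>i. A (e i)) {..<card G}"
      unfolding disjoint_family_on_def
    proof (intro ballI impI)
      fix i j assume ij: "i \<in> {..<card G}" "j \<in> {..<card G}" "i \<noteq> j"
      then have "e i \<noteq> e j" using e by (auto simp: bij_betw_def inj_on_def)
      moreover have "e i \<in> F \<rightarrow>\<^sub>E insert 0 Q" "e j \<in> F \<rightarrow>\<^sub>E insert 0 Q"
        using eG ij unfolding G_def by auto
      ultimately obtain t where "t \<in> F" "e i t \<noteq> e j t" by (meson PiE_ext)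
      then show "A (e i) \<inter> A (e j) = {}" unfolding A_def by force
    qed
    have "card G > 0" using False finG by (simp add: card_gt_0_iff)
    then have ne: "{..<card G} \<noteq> {}" by auto
    have "prob {\<omega> \<in> space M. X \<omega> = x} = (\<Prod>i\<in>{..<card G}. prob (?N i -` B i \<inter> space M))"
      unfolding eq
      by (rule indep_varsD_finite[OF num_points_indep[OF A disj] ne finite_lessThan]) (auto simp: B_def)
    also have "\<dots> = (\<Prod>i\<in>{..<card G}. if e i \<in> x then p (e i) else 1 - p (e i))"
      using N_zero N_nonzero by (intro prod.cong) (auto simp: B_def)
    also have "\<dots> = subset_weight G p x"
      unfolding subset_weight_def using e by (rule prod.reindex_bij_betw)
    finally have "prob {\<omega> \<in> space M. X \<omega> = x} = subset_weight G p x" .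
    moreover have "{\<omega> \<in> space M. X \<omega> = x} \<in> events"
      unfolding eq using N ne
      by (intro sets.finite_INT finite_lessThan) (auto simp: B_def intro!: measurable_sets)
    ultimately show ?thesis by simp
  qed
  have X: "X \<omega> \<in> Pow G" for \<omega> unfolding X_def by auto
  have finX: "finite (X \<omega>)" for \<omega> using X[of \<omega>] finG by (auto intro: finite_subset)
  \<comment> \<open>Rounding is monotone and the maximum is attained, so rounding commutes with it:
    the type of a maximal function occurs and carries the rounded maximum.\<close>
  have max_X: "max_at (X \<omega>) t = round_down Q (\<eta> \<omega> t)" if \<omega>: "\<omega> \<in> space M" and t: "t \<in> F" for \<omega> t
  proof (rule antisym)
    show "max_at (X \<omega>) t \<le> round_down Q (\<eta> \<omega> t)"
    proof (rule max_at_le[OF finX])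
      fix g assume "g \<in> X \<omega>"
      then obtain f where f: "f \<in> A g" "0 < \<Phi> \<omega> f"
        unfolding X_def num_points_eq_0_iff by auto
      have "g t = round_down Q (f t)" using f(1) t unfolding A_def by auto
      also have "\<dots> \<le> round_down Q (\<eta> \<omega> t)"
        using point_le_\<eta>[OF \<omega> f(2), of t] by (intro round_down_mono[OF Q(1)]) linarith
      finally show "g t \<le> round_down Q (\<eta> \<omega> t)" .
    qed (rule round_down_nonneg[OF Q(1)])
    show "round_down Q (\<eta> \<omega> t) \<le> max_at (X \<omega>) t"
    proof (cases "0 < round_down Q (\<eta> \<omega> t)")
      case True
      then obtain d where "d \<in> Q" "d \<le> \<eta> \<omega> t" using round_down_pos_iff[OF Q] by blast
      then have "0 < \<eta> \<omega> t" using Q(2) by force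
      then obtain f where f: "0 < \<Phi> \<omega> f" "f t = \<eta> \<omega> t" by (rule \<eta>_attained[OF \<omega>])
      define g where "g = restrict (\<lambda>t. round_down Q (f t)) F"
      have "round_down Q (f s) \<in> insert 0 Q" for s
        using round_down_in[OF Q(1), of "f s"] by auto
      then have "g \<in> F \<rightarrow>\<^sub>E insert 0 Q" unfolding g_def by auto
      moreover have "0 < g t" using t True f(2) unfolding g_def by simp
      ultimately have "g \<in> G" using t unfolding G_def by blast
      moreover have "f \<in> A g" using point_in_space[OF \<omega> f(1)] unfolding A_def g_def by auto
      ultimately have "g \<in> X \<omega>" using f(1) unfolding X_def num_points_eq_0_iff by auto
      then have "g t \<le> max_at (X \<omega>) t" using finX by (intro max_at_upper)
      then show ?thesis using t f(2) by (simp add: g_def)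
    next
      case False
      then show ?thesis using max_at_nonneg[OF finX, of \<omega> t] by linarith
    qed
  qed
  define R where "R g x \<longleftrightarrow> hits F1 g (max_at x) \<and> hits F2 g (max_at x)" for g x
  let ?U = "\<lambda>F x. restrict (max_at x) F"
  let ?w = "subset_weight G p"
  have V1: "V F1 \<omega> = ?U F1 (X \<omega>)" and V2: "V F2 \<omega> = ?U F2 (X \<omega>)" if "\<omega> \<in> space M" for \<omega>
    unfolding V_def using max_X[OF that] by (auto simp: F_def intro!: restrict_ext)
  have P: "prob {\<omega> \<in> space M. \<phi> (X \<omega>)} = (\<Sum>x\<in>Pow G. ?w x * of_bool (\<phi> x))" for \<phi>
    using ev X finG by (subst prob_finite_range[of "Pow G"]) auto
  have "{\<omega> \<in> space M. C (V F1 \<omega>) (V F2 \<omega>)} = {\<omega> \<in> space M. C (?U F1 (X \<omega>)) (?U F2 (X \<omega>))}"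
    using V1 V2 by (auto simp: conj_commute)
  then have P1: "prob {\<omega> \<in> space M. C (V F1 \<omega>) (V F2 \<omega>)} =
      (\<Sum>x\<in>Pow G. ?w x * of_bool (C (?U F1 x) (?U F2 x)))"
    using P[of "\<lambda>x. C (?U F1 x) (?U F2 x)"] by simp
  have "{q \<in> space (M \<Otimes>\<^sub>M M). C (V F1 (fst q)) (V F2 (snd q))} =
      {q \<in> space (M \<Otimes>\<^sub>M M). C (?U F1 (X (fst q))) (?U F2 (X (snd q)))}"
    using V1 V2 by (auto simp: space_pair_measure)
  then have P2: "measure (M \<Otimes>\<^sub>M M) {q \<in> space (M \<Otimes>\<^sub>M M). C (V F1 (fst q)) (V F2 (snd q))} =
      (\<Sum>(x, y)\<in>Pow G \<times> Pow G. ?w x * ?w y * of_bool (C (?U F1 x) (?U F2 y)))"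
    using ev X finG
    by (simp only:) (subst prob_finite_range_pair[of "Pow G"], auto intro!: sum.cong)
  have p: "0 \<le> p g \<and> p g \<le> 1" for g
    unfolding p_def by (simp add: measure_nonneg)
  have "\<bar>prob {\<omega> \<in> space M. C (V F1 \<omega>) (V F2 \<omega>)} -
      measure (M \<Otimes>\<^sub>M M) {q \<in> space (M \<Otimes>\<^sub>M M). C (V F1 (fst q)) (V F2 (snd q))}\<bar>
    \<le> 2 * (\<Sum>g\<in>G. p g * (\<Sum>x\<in>Pow G. ?w x * of_bool (R g x)))"
    unfolding P1 P2 R_def using finG p by (rule discrete_mixing_bound)
  also have "\<dots> = 2 * (\<Sum>g\<in>G. p g * prob {\<omega> \<in> space M. R g (X \<omega>)})"
    unfolding P ..
  finally have "ennreal \<bar>prob {\<omega> \<in> space M. C (V F1 \<omega>) (V F2 \<omega>)} -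
      measure (M \<Otimes>\<^sub>M M) {q \<in> space (M \<Otimes>\<^sub>M M). C (V F1 (fst q)) (V F2 (snd q))}\<bar>
    \<le> ennreal (2 * (\<Sum>g\<in>G. p g * prob {\<omega> \<in> space M. R g (X \<omega>)}))"
    by (rule ennreal_leI)
  also have "\<dots> = 2 * (\<Sum>g\<in>G. ennreal (p g) * emeasure M {\<omega> \<in> space M. R g (X \<omega>)})"
    using p by (simp add: ennreal_mult sum_nonneg emeasure_eq_measure sum_ennreal[symmetric] del: sum_ennreal)
  also have "\<dots> \<le> 2 * (\<Sum>g\<in>G. emeasure M {\<omega> \<in> space M. R g (X \<omega>)} * emeasure \<mu> (A g))"
  proof (intro mult_left_mono sum_mono)
    fix g assume g: "g \<in> G"
    have "p g \<le> measure \<mu> (A g)"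
      unfolding p_def using exp_ge_add_one_self[of "- measure \<mu> (A g)"] by linarith
    then have "ennreal (p g) \<le> emeasure \<mu> (A g)"
      using A_fin[OF g] by (simp add: emeasure_eq_ennreal_measure ennreal_leI)
    then show "ennreal (p g) * emeasure M {\<omega> \<in> space M. R g (X \<omega>)} \<le>
        emeasure M {\<omega> \<in> space M. R g (X \<omega>)} * emeasure \<mu> (A g)"
      by (subst mult.commute) (rule mult_left_mono, auto)
  qed auto
  also have "(\<Sum>g\<in>G. emeasure M {\<omega> \<in> space M. R g (X \<omega>)} * emeasure \<mu> (A g)) =
      (\<integral>\<^sup>+ f. (\<Sum>g\<in>G. emeasure M {\<omega> \<in> space M. R g (X \<omega>)} * indicator (A g) f) \<partial>\<mu>)"
    by (subst nn_integral_sum) (auto simp: nn_integral_cmult_indicator)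
  also have "\<dots> \<le> (\<integral>\<^sup>+ f. both_hit_prob F1 F2 Q f \<partial>\<mu>)"
  proof (rule nn_integral_mono)
    fix f assume f: "f \<in> space \<mu>"
    \<comment> \<open>\<open>f\<close> has exactly one type, so at most one summand survives. None
      survives if \<open>f\<close> rounds to zero on all of \<open>F\<close>, which is why only an
      inequality is claimed.\<close>
    define g0 where "g0 = restrict (\<lambda>t. round_down Q (f t)) F"
    have ind: "indicator (A g) f = (if g = g0 then 1 else 0 :: ennreal)" if "g \<in> G" for g
    proof -
      have "f \<in> A g \<longleftrightarrow> g = g0"
      proof
        assume "f \<in> A g"
        then show "g = g0"
          using that unfolding A_def G_def g0_def by (auto intro!: PiE_ext)
      qed (use f in \<open>auto simp: A_def g0_def\<close>)
      then show ?thesis by (simp add: indicator_def)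
    qed
    have "(\<Sum>g\<in>G. emeasure M {\<omega> \<in> space M. R g (X \<omega>)} * indicator (A g) f) =
        (\<Sum>g\<in>G. if g = g0 then emeasure M {\<omega> \<in> space M. R g (X \<omega>)} else 0)"
      using ind by (intro sum.cong) auto
    also have "\<dots> \<le> emeasure M {\<omega> \<in> space M. R g0 (X \<omega>)}"
      using finG by (simp add: sum.delta')
    also have "{\<omega> \<in> space M. R g0 (X \<omega>)} = {\<omega> \<in> space M.
        hits F1 (\<lambda>t. round_down Q (f t)) (\<lambda>t. round_down Q (\<eta> \<omega> t)) \<and>
        hits F2 (\<lambda>t. round_down Q (f t)) (\<lambda>t. round_down Q (\<eta> \<omega> t))}"
      unfolding R_def hits_def using max_X by (auto simp: g0_def F_def)
    finally show "(\<Sum>g\<in>G. emeasure M {\<omega> \<in> space M. R g (X \<omega>)} * indicator (A g) f) \<le>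
        both_hit_prob F1 F2 Q f"
      unfolding both_hit_prob_def .
  qed
  finally show ?thesis by (simp add: mult_left_mono)
qed

end

subsection \<open>Refining the thresholds\<close>

text \<open>Rounded values are ordered exactly as the sets of thresholds below them are included.
  This form shows the effect of a finer grid: the universal condition gets stricter, and only the
  existential one could get weaker.\<close>

lemma hits_round_down_iff:
  assumes Q: "finite Q" "Q \<subseteq> {0<..}"
  shows "hits F (\<lambda>t. round_down Q (f t)) (\<lambda>t. round_down Q (u t)) \<longleftrightarrow>
    (\<exists>t\<in>F. (\<exists>d\<in>Q. d \<le> f t) \<and> (\<forall>d\<in>Q. d \<le> u t \<longrightarrow> d \<le> f t))"
proof -
  have "round_down Q x \<le> round_down Q y \<longleftrightarrow> (\<forall>d\<in>Q. d \<le> x \<longrightarrow> d \<le> y)" for x y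
  proof
    assume le: "round_down Q x \<le> round_down Q y"
    show "\<forall>d\<in>Q. d \<le> x \<longrightarrow> d \<le> y"
    proof (intro ballI impI)
      fix d assume d: "d \<in> Q" "d \<le> x"
      have "0 < d" using d Q by auto
      then have "d \<le> round_down Q y"
        using d(2) le le_round_down_iff[OF Q(1) d(1), of x] by linarith
      then show "d \<le> y" using le_round_down_iff[OF Q(1) d(1) \<open>0 < d\<close>] by simp
    qed
  qed (auto intro: round_down_mono[OF Q(1)])
  then show ?thesis unfolding hits_def round_down_pos_iff[OF Q] by simp
qed

text \<open>
  All added thresholds lie above \<^term>\<open>Min Q\<close>, so that refining the grid never enlarges the set of
  functions that can hit the maximum. This set has finite exponent measure, and the bounds decrease
  to the one without discretisation.
\<close>

definition thresholds :: "real set \<Rightarrow> nat \<Rightarrow> real set" where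
  "thresholds Q n = Q \<union> (\<lambda>k. Min Q + \<bar>real_of_rat (from_nat k)\<bar>) ` {..<n}"

lemma thresholds_props:
  assumes "finite Q" "Q \<noteq> {}" "Q \<subseteq> {0<..}"
  shows "finite (thresholds Q n)" "thresholds Q n \<subseteq> {0<..}" "Q \<subseteq> thresholds Q n"
    "thresholds Q n \<subseteq> thresholds Q (Suc n)"
    and "(\<exists>d\<in>thresholds Q n. d \<le> x) \<longleftrightarrow> Min Q \<le> x"
proof -
  have "0 < Min Q" using assms by auto
  then show "thresholds Q n \<subseteq> {0<..}"
    using assms unfolding thresholds_def by (auto simp del: Min_gr_iff intro: add_pos_nonneg)
  show "finite (thresholds Q n)" "Q \<subseteq> thresholds Q n" "thresholds Q n \<subseteq> thresholds Q (Suc n)"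
    using assms unfolding thresholds_def by auto
  have "Min Q \<le> d" if "d \<in> thresholds Q n" for d
    using that assms(1) unfolding thresholds_def by auto
  moreover have "Min Q \<in> thresholds Q n"
    using assms unfolding thresholds_def by simp
  ultimately show "(\<exists>d\<in>thresholds Q n. d \<le> x) \<longleftrightarrow> Min Q \<le> x"
    by (meson order_trans)
qed

lemma thresholds_dense:
  assumes Q: "finite Q" "Q \<noteq> {}" "Q \<subseteq> {0<..}" and x: "Min Q \<le> x" "x < y"
  obtains n d where "d \<in> thresholds Q n" "x < d" "d \<le> y"
proof -
  obtain q where q: "x - Min Q < real_of_rat q" "real_of_rat q < y - Min Q"
    using of_rat_dense[of "x - Min Q" "y - Min Q"] x by auto
  \<comment> \<open>\<open>q\<close> is positive since \<open>Min Q \<le> x\<close>, so the absolute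
    value leaves it unchanged; the successor is needed because a grid uses the indices strictly
    below its parameter.\<close>
  have "Min Q + \<bar>real_of_rat (from_nat (to_nat q))\<bar> \<in> thresholds Q (Suc (to_nat q))"
    unfolding thresholds_def by blast
  moreover have "\<bar>real_of_rat (from_nat (to_nat q))\<bar> = real_of_rat q"
    unfolding from_nat_to_nat using q x by (intro abs_of_nonneg) linarith
  ultimately show ?thesis
    using that[of "Min Q + real_of_rat q" "Suc (to_nat q)"] q by simp
qed

lemma hits_thresholds_mono:
  assumes Q: "finite Q" "Q \<noteq> {}" "Q \<subseteq> {0<..}"
    and "hits F (\<lambda>t. round_down (thresholds Q (Suc n)) (f t)) (\<lambda>t. round_down (thresholds Q (Suc n)) (u t))"
  shows "hits F (\<lambda>t. round_down (thresholds Q n) (f t)) (\<lambda>t. round_down (thresholds Q n) (u t))"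
  using assms(4) thresholds_props(4)[OF Q, of n]
  unfolding hits_round_down_iff[OF thresholds_props(1,2)[OF Q]] thresholds_props(5)[OF Q] by blast

text \<open>If \<open>f t < u t\<close> at a point of \<open>F\<close>, then either
  \<open>f t\<close> lies below \<open>Min Q\<close> and no grid allows a hit there, or some grid
  has a threshold above \<open>f t\<close> and at most \<open>u t\<close>. As the grids increase and
  \<open>F\<close> is finite, one grid would rule out all points of \<open>F\<close>
  together.\<close>

lemma hits_thresholds_limit:
  assumes Q: "finite Q" "Q \<noteq> {}" "Q \<subseteq> {0<..}" and F: "finite F" "F \<subseteq> S"
    and hits: "\<And>n. hits F (\<lambda>t. round_down (thresholds Q n) (f t)) (\<lambda>t. round_down (thresholds Q n) (u t))"
  shows "not_less_on S f u"
proof (rule ccontr)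
  assume "\<not> not_less_on S f u"
  then have less: "f t < u t" if "t \<in> F" for t
    using that F unfolding not_less_on_def by force
  define P where "P n t \<longleftrightarrow> Min Q \<le> f t \<and> (\<forall>d\<in>thresholds Q n. d \<le> u t \<longrightarrow> d \<le> f t)" for n t
  have "\<exists>n. \<not> P n t" if t: "t \<in> F" for t
  proof (cases "Min Q \<le> f t")
    case True
    then obtain n d where "d \<in> thresholds Q n" "f t < d" "d \<le> u t"
      using thresholds_dense[OF Q True less[OF t]] by blast
    then show ?thesis unfolding P_def by force
  qed (auto simp: P_def)
  then obtain N where N: "\<And>t. t \<in> F \<Longrightarrow> \<not> P (N t) t" by metis
  have antimono: "P n t \<Longrightarrow> m \<le> n \<Longrightarrow> P m t" for m n t
  proof -
    have "thresholds Q m \<subseteq> thresholds Q n" if "m \<le> n"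
      using lift_Suc_mono_le[of "thresholds Q", OF thresholds_props(4)[OF Q] that] .
    then show "P n t \<Longrightarrow> m \<le> n \<Longrightarrow> P m t" unfolding P_def by blast
  qed
  obtain t where "t \<in> F" "P (Max (N ` F)) t"
    using hits[of "Max (N ` F)"]
    unfolding hits_round_down_iff[OF thresholds_props(1,2)[OF Q]] thresholds_props(5)[OF Q] P_def by blast
  then show False using antimono[of "Max (N ` F)" t "N t"] N[of t] F(1) by simp
qed

context max_id
begin

text \<open>Two passages to the limit from above: the integrals decrease to the integral of the
  infimum, starting from a finite value, and for fixed \<open>f\<close> the events decrease to their
  intersection. There \<open>f\<close> hits on every grid, so it is at least \<open>\<eta>\<close>
  somewhere in \<open>F1\<close> and somewhere in \<open>F2\<close>. The final integrand enters only
  as a pointwise upper bound.\<close>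

lemma both_hit_prob_limit:
  assumes Q: "finite Q" "Q \<noteq> {}" "Q \<subseteq> {0<..}"
    and F: "finite F1" "finite F2" "F1 \<subseteq> S1" "F2 \<subseteq> S2"
    and S: "\<And>f. f \<in> cont_fun UNIV \<Longrightarrow> {\<omega> \<in> space M. not_less_on S1 f (\<eta> \<omega>)} \<in> events"
      "\<And>f. f \<in> cont_fun UNIV \<Longrightarrow> {\<omega> \<in> space M. not_less_on S2 f (\<eta> \<omega>)} \<in> events"
    and le: "\<And>n. c \<le> (\<integral>\<^sup>+ f. both_hit_prob F1 F2 (thresholds Q n) f \<partial>\<mu>)"
  shows "c \<le> (\<integral>\<^sup>+ f. emeasure M {\<omega> \<in> space M. not_less_on S1 f (\<eta> \<omega>) \<and> not_less_on S2 f (\<eta> \<omega>)} \<partial>\<mu>)"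
proof -
  note thr = thresholds_props(1,2)[OF Q]
  define E where "E n f = {\<omega> \<in> space M.
     hits F1 (\<lambda>t. round_down (thresholds Q n) (f t)) (\<lambda>t. round_down (thresholds Q n) (\<eta> \<omega> t)) \<and>
     hits F2 (\<lambda>t. round_down (thresholds Q n) (f t)) (\<lambda>t. round_down (thresholds Q n) (\<eta> \<omega> t))}" for n f
  have E_meas: "E n f \<in> events" for n f
    unfolding E_def hits_def using thr[of n] F by measurable
  have E_dec: "E (Suc n) f \<subseteq> E n f" for n f
    unfolding E_def using hits_thresholds_mono[OF Q] by blast
  have bhp: "both_hit_prob F1 F2 (thresholds Q n) f = emeasure M (E n f)" for n f
    unfolding both_hit_prob_def E_def ..
  have "c \<le> (INF n. \<integral>\<^sup>+ f. both_hit_prob F1 F2 (thresholds Q n) f \<partial>\<mu>)"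
    using le by (rule INF_greatest)
  also have "\<dots> = (\<integral>\<^sup>+ f. (INF n. both_hit_prob F1 F2 (thresholds Q n) f) \<partial>\<mu>)"
  proof (rule nn_integral_monotone_convergence_INF_AE[symmetric])
    show "AE f in \<mu>. both_hit_prob F1 F2 (thresholds Q (Suc n)) f \<le> both_hit_prob F1 F2 (thresholds Q n) f" for n
      unfolding bhp using emeasure_mono[OF E_dec E_meas] by simp
    show "both_hit_prob F1 F2 (thresholds Q n) \<in> borel_measurable \<mu>" for n
      using both_hit_prob_measurable[OF F(1,2) thr(1)] .
    show "(\<integral>\<^sup>+ f. both_hit_prob F1 F2 (thresholds Q 0) f \<partial>\<mu>) < \<infinity>"
      using nn_integral_both_hit_prob_finite[OF F(1,2) thr] .
  qed
  also have "\<dots> \<le> (\<integral>\<^sup>+ f. emeasure M {\<omega> \<in> space M. not_less_on S1 f (\<eta> \<omega>) \<and> not_less_on S2 f (\<eta> \<omega>)} \<partial>\<mu>)"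
  proof (rule nn_integral_mono)
    fix f assume "f \<in> space \<mu>"
    then have f: "f \<in> cont_fun UNIV" unfolding space_exponent by simp
    have "(INF n. both_hit_prob F1 F2 (thresholds Q n) f) = emeasure M (\<Inter>n. E n f)"
      unfolding bhp
    proof (rule INF_emeasure_decseq)
      show "range (\<lambda>n. E n f) \<subseteq> events" using E_meas by auto
      show "decseq (\<lambda>n. E n f)" using E_dec by (rule decseq_SucI)
    qed simp
    also have "\<dots> \<le> emeasure M {\<omega> \<in> space M. not_less_on S1 f (\<eta> \<omega>) \<and> not_less_on S2 f (\<eta> \<omega>)}"
    proof (rule emeasure_mono)
      show "(\<Inter>n. E n f) \<subseteq> {\<omega> \<in> space M. not_less_on S1 f (\<eta> \<omega>) \<and> not_less_on S2 f (\<eta> \<omega>)}"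
      proof
        fix \<omega> assume "\<omega> \<in> (\<Inter>n. E n f)"
        then have "\<omega> \<in> E n f" for n by blast
        then show "\<omega> \<in> {\<omega> \<in> space M. not_less_on S1 f (\<eta> \<omega>) \<and> not_less_on S2 f (\<eta> \<omega>)}"
          unfolding E_def
          using hits_thresholds_limit[OF Q F(1,3)] hits_thresholds_limit[OF Q F(2,4)] by blast
      qed
      show "{\<omega> \<in> space M. not_less_on S1 f (\<eta> \<omega>) \<and> not_less_on S2 f (\<eta> \<omega>)} \<in> events"
        by (intro sets.sets_Collect_conj S f)
    qed
    finally show "(INF n. both_hit_prob F1 F2 (thresholds Q n) f) \<le>
      emeasure M {\<omega> \<in> space M. not_less_on S1 f (\<eta> \<omega>) \<and> not_less_on S2 f (\<eta> \<omega>)}" .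
  qed
  finally show ?thesis .
qed

end

subsection \<open>Approximation by cylinder events\<close>

text \<open>The inequality is not stable under disjoint unions, which excludes a Dynkin system
  argument. Instead, every set of the generated sigma-field is approximated by the algebra in
  symmetric difference for \<open>\<nu>\<close>, the sum of both measures; replacing
  \<open>C\<close> by \<open>B\<close> changes the difference of the measures by at most
  \<open>\<nu>\<close> of the symmetric difference.\<close>

lemma algebra_difference_bound:
  assumes A: "algebra \<Omega> \<A>" "sets P = sigma_sets \<Omega> \<A>" "sets Q = sets P"
    and fin: "finite_measure P" "finite_measure Q"
    and bound: "\<And>C. C \<in> \<A> \<Longrightarrow> \<bar>measure P C - measure Q C\<bar> \<le> r"
    and C: "C \<in> sets P"
  shows "\<bar>measure P C - measure Q C\<bar> \<le> r"
proof -
  interpret P: finite_measure P by fact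
  interpret Q: finite_measure Q by fact
  interpret algebra \<Omega> \<A> by fact
  define \<nu> where "\<nu> X = measure P X + measure Q X" for X
  define approx where "approx X \<longleftrightarrow> X \<in> sets P \<and>
    (\<forall>e>0. \<exists>B\<in>\<A>. \<nu> (X - B) + \<nu> (B - X) < e)" for X
  have sets: "B \<in> sets P" "B \<in> sets Q" if "B \<in> \<A>" for B
    using that A by auto
  have space: "\<Omega> \<in> sets P" using A(2) top by auto
  have \<nu>_mono: "\<nu> X \<le> \<nu> Y" if "X \<subseteq> Y" "Y \<in> sets P" for X Y
    unfolding \<nu>_def using that A(3) by (intro add_mono P.finite_measure_mono Q.finite_measure_mono) auto
  have \<nu>_Un: "\<nu> (X \<union> Y) \<le> \<nu> X + \<nu> Y" if "X \<in> sets P" "Y \<in> sets P" for X Y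
    unfolding \<nu>_def
    using measure_Un_le[of X P Y] measure_Un_le[of X Q Y] that A(3) by simp
  have "approx X" if "X \<in> sigma_sets \<Omega> \<A>" for X
    using that
  proof (induction X rule: sigma_sets.induct)
    case (Basic a)
    then show ?case unfolding approx_def using sets by (auto simp: \<nu>_def intro!: bexI[of _ a])
  next
    case Empty
    then show ?case unfolding approx_def by (auto simp: \<nu>_def intro!: bexI[of _ "{}"])
  next
    case (Compl a)
    show ?case
      unfolding approx_def
    proof (intro conjI allI impI)
      show "\<Omega> - a \<in> sets P" using Compl space unfolding approx_def by auto
      fix e :: real assume "0 < e"
      then obtain B where B: "B \<in> \<A>" "\<nu> (a - B) + \<nu> (B - a) < e"
        using Compl.IH unfolding approx_def by blast
      have "a \<subseteq> \<Omega>" using Compl.hyps sigma_sets_into_sp[OF space_closed] by blast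
      moreover have "B \<subseteq> \<Omega>" using B sets_into_space by blast
      ultimately have "\<Omega> - a - (\<Omega> - B) = B - a" "\<Omega> - B - (\<Omega> - a) = a - B" by auto
      then show "\<exists>B\<in>\<A>. \<nu> (\<Omega> - a - B) + \<nu> (B - (\<Omega> - a)) < e"
        using B by (intro bexI[of _ "\<Omega> - B"]) auto
    qed
  next
    case (Union a)
    show ?case
      unfolding approx_def
    proof (intro conjI allI impI)
      have a: "a i \<in> sets P" for i using Union.IH unfolding approx_def by auto
      then show U: "(\<Union>i. a i) \<in> sets P" by auto
      fix e :: real assume e: "0 < e"
      \<comment> \<open>Half of \<open>e\<close> pays for cutting the union off after
        \<open>n\<close> sets, the other half for approximating these sets.\<close>
      define V where "V n = (\<Union>i<n. a i)" for n
      have V: "V n \<in> sets P" for n unfolding V_def using a by auto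
      have UV: "(\<Union>n. V n) = (\<Union>i. a i)" unfolding V_def by (auto intro: lessI)
      have inc: "incseq V" unfolding V_def by (rule incseq_SucI) (auto intro: less_SucI)
      have "(\<lambda>n. \<nu> (V n)) \<longlonglongrightarrow> \<nu> (\<Union>n. V n)"
        unfolding \<nu>_def using inc V A(3)
        by (intro tendsto_add P.finite_Lim_measure_incseq Q.finite_Lim_measure_incseq) auto
      then have "eventually (\<lambda>n. \<nu> (\<Union>i. a i) - e / 2 < \<nu> (V n)) sequentially"
        using e unfolding UV by (intro order_tendstoD(1)) auto
      then obtain n where n: "\<nu> (\<Union>i. a i) - e / 2 < \<nu> (V n)"
        by (auto simp: eventually_sequentially)
      have Vn: "V n \<subseteq> (\<Union>i. a i)" unfolding V_def by auto
      have "\<nu> ((\<Union>i. a i) - V n) = \<nu> (\<Union>i. a i) - \<nu> (V n)"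
        using U V[of n] Vn A(3) P.finite_measure_Diff[of "\<Union>i. a i" "V n"]
          Q.finite_measure_Diff[of "\<Union>i. a i" "V n"] unfolding \<nu>_def by auto
      with n have n': "\<nu> ((\<Union>i. a i) - V n) < e / 2" by linarith
      \<comment> \<open>The \<open>n\<close> approximations cost at most
        \<open>n * d \<le> e / 2\<close> together; adding 1 keeps \<open>d\<close> defined and
        positive for \<open>n = 0\<close>.\<close>
      define d where "d = e / (2 * (real n + 1))"
      have "\<forall>i. \<exists>B\<in>\<A>. \<nu> (a i - B) + \<nu> (B - a i) < d"
      proof
        fix i
        have "0 < d" using e by (simp add: d_def)
        then show "\<exists>B\<in>\<A>. \<nu> (a i - B) + \<nu> (B - a i) < d"
          using Union.IH[of i] unfolding approx_def by blast
      qed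
      then obtain B where B: "\<And>i. B i \<in> \<A>"
        "\<And>i. \<nu> (a i - B i) + \<nu> (B i - a i) < d"
        by metis
      define W where "W k = (\<Union>i<k. B i)" for k
      have W: "W k \<in> \<A>" for k unfolding W_def using B by auto
      have VW: "\<nu> (V k - W k) + \<nu> (W k - V k) \<le> real k * d" for k
      proof (induction k)
        case 0
        then show ?case by (simp add: V_def W_def \<nu>_def)
      next
        case (Suc k)
        have S: "V (Suc k) = V k \<union> a k" "W (Suc k) = W k \<union> B k"
          unfolding V_def W_def lessThan_Suc by auto
        note meas = sets.Un sets.Diff V a sets(1)[OF W] sets(1)[OF B(1)]
        have "\<nu> (V (Suc k) - W (Suc k)) \<le> \<nu> ((V k - W k) \<union> (a k - B k))"
          unfolding S by (intro \<nu>_mono meas) blast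
        also have "\<dots> \<le> \<nu> (V k - W k) + \<nu> (a k - B k)" by (intro \<nu>_Un meas)
        finally have 1: "\<nu> (V (Suc k) - W (Suc k)) \<le> \<nu> (V k - W k) + \<nu> (a k - B k)" .
        have "\<nu> (W (Suc k) - V (Suc k)) \<le> \<nu> ((W k - V k) \<union> (B k - a k))"
          unfolding S by (intro \<nu>_mono meas) blast
        also have "\<dots> \<le> \<nu> (W k - V k) + \<nu> (B k - a k)" by (intro \<nu>_Un meas)
        finally have "\<nu> (W (Suc k) - V (Suc k)) \<le> \<nu> (W k - V k) + \<nu> (B k - a k)" .
        moreover have "real (Suc k) * d = real k * d + d"
          by (simp add: algebra_simps)
        ultimately show ?case using 1 Suc B(2)[of k] by linarith
      qed
      have "real n * d \<le> e / 2" using e by (simp add: d_def field_simps)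
      with VW[of n] have VW': "\<nu> (V n - W n) + \<nu> (W n - V n) \<le> e / 2" by linarith
      note meas = sets.Un sets.Diff V a sets(1)[OF W] U
      have "\<nu> ((\<Union>i. a i) - W n) \<le> \<nu> (((\<Union>i. a i) - V n) \<union> (V n - W n))"
        by (intro \<nu>_mono meas) blast
      also have "\<dots> \<le> \<nu> ((\<Union>i. a i) - V n) + \<nu> (V n - W n)" by (intro \<nu>_Un meas)
      finally have "\<nu> ((\<Union>i. a i) - W n) \<le> \<nu> ((\<Union>i. a i) - V n) + \<nu> (V n - W n)" .
      moreover have "\<nu> (W n - (\<Union>i. a i)) \<le> \<nu> (W n - V n)"
        by (intro \<nu>_mono meas) (auto simp: UV[symmetric])
      ultimately have "\<nu> ((\<Union>i. a i) - W n) + \<nu> (W n - (\<Union>i. a i)) < e"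
        using n' VW' by linarith
      then show "\<exists>B\<in>\<A>. \<nu> ((\<Union>i. a i) - B) + \<nu> (B - (\<Union>i. a i)) < e"
        using W by blast
    qed
  qed
  then have C': "approx C" using C A(2) by auto
  show ?thesis
  proof (rule field_le_epsilon)
    fix e :: real assume "0 < e"
    then obtain B where B: "B \<in> \<A>" "\<nu> (C - B) + \<nu> (B - C) < e"
      using C' unfolding approx_def by blast
    have *: "\<bar>measure N C - measure N B\<bar> \<le> measure N (C - B) + measure N (B - C)"
      if "finite_measure N" "sets N = sets P" for N
    proof -
      interpret N: finite_measure N by fact
      have CB [simp]: "C \<in> sets N" "B \<in> sets N" using C sets B that by auto
      have "measure N C \<le> measure N (B \<union> (C - B))" "measure N B \<le> measure N (C \<union> (B - C))"
        by (auto intro!: N.finite_measure_mono)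
      moreover have "measure N (B \<union> (C - B)) \<le> measure N B + measure N (C - B)"
        "measure N (C \<union> (B - C)) \<le> measure N C + measure N (B - C)"
        by (rule measure_Un_le; intro sets.Diff CB)+
      ultimately show ?thesis
        using measure_nonneg[of N "C - B"] measure_nonneg[of N "B - C"] by linarith
    qed
    have "measure N X \<ge> 0" for N :: "'a measure" and X by simp
    then show "\<bar>measure P C - measure Q C\<bar> \<le> r + e"
      using *[OF fin(1)] *[OF fin(2)] A(3) bound[OF B(1)] B(2) unfolding \<nu>_def by (smt (verit))
  qed
qed

section \<open>Cylinder sets given by finitely many threshold comparisons\<close>

definition profile :: "('a \<times> real) set \<Rightarrow> ('a \<Rightarrow> real) \<Rightarrow> ('a \<times> real) set" where
  "profile J h = {j \<in> J. snd j \<le> h (fst j)}"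

lemma profile_cong:
  assumes "\<And>t d. (t, d) \<in> J \<Longrightarrow> d \<le> h t \<longleftrightarrow> d \<le> k t"
  shows "profile J h = profile J k"
proof -
  have "snd j \<le> h (fst j) \<longleftrightarrow> snd j \<le> k (fst j)" if "j \<in> J" for j
    using assms[of "fst j" "snd j"] that by simp
  then show ?thesis unfolding profile_def by blast
qed

text \<open>A cylinder is an arbitrary condition \<C> on which of finitely many comparisons hold.
  These are the events whose outcome is not changed by rounding to a grid that contains the
  thresholds in \<open>J\<close>.\<close>

definition cylinders :: "'a::metric_space set \<Rightarrow> ('a \<Rightarrow> real) set set" where
  "cylinders S = {{h \<in> cont_fun S. profile J h \<in> \<C>} | J \<C>. finite J \<and> J \<subseteq> S \<times> {0<..}}"

text \<open>Complements negate the condition on the profile. For intersections the two index sets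
  are merged, and each old profile is recovered as a trace of the joint one.\<close>

lemma algebra_cylinders: "algebra (cont_fun S) (cylinders S)"
  unfolding algebra_iff_Int
proof (intro conjI ballI)
  show "cylinders S \<subseteq> Pow (cont_fun S)" unfolding cylinders_def by auto
  show "{} \<in> cylinders S"
    unfolding cylinders_def by (intro CollectI exI[of _ "{}"]) auto
  fix a assume "a \<in> cylinders S"
  then obtain J \<C> where a: "a = {h \<in> cont_fun S. profile J h \<in> \<C>}" "finite J" "J \<subseteq> S \<times> {0<..}"
    unfolding cylinders_def by blast
  then have "cont_fun S - a = {h \<in> cont_fun S. profile J h \<in> - \<C>}" by auto
  then show "cont_fun S - a \<in> cylinders S" unfolding cylinders_def using a by blast
  fix b assume "b \<in> cylinders S"
  then obtain J' \<C>' where b: "b = {h \<in> cont_fun S. profile J' h \<in> \<C>'}" "finite J'" "J' \<subseteq> S \<times> {0<..}"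
    unfolding cylinders_def by blast
  have "profile J h = profile (J \<union> J') h \<inter> J" "profile J' h = profile (J \<union> J') h \<inter> J'" for h
    unfolding profile_def by auto
  then have "a \<inter> b = {h \<in> cont_fun S. profile (J \<union> J') h \<in> {B. B \<inter> J \<in> \<C> \<and> B \<inter> J' \<in> \<C>'}}"
    unfolding a b by auto
  moreover have "finite (J \<union> J')" "J \<union> J' \<subseteq> S \<times> {0<..}" using a b by auto
  ultimately show "a \<inter> b \<in> cylinders S" unfolding cylinders_def by blast
qed

lemma sets_borel_sigma_cylinders:
  fixes S :: "'a::metric_space set"
  assumes "second_countable (top_of_set S)"
  shows "sets (borel_sigma (compact_conv_topology S)) = sigma_sets (cont_fun S) (cylinders S)"
    (is "sets ?N = _")
proof
  show "sets ?N \<subseteq> sigma_sets (cont_fun S) (cylinders S)"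
    unfolding sets_borel_sigma_compact_conv[OF assms]
  proof (rule sigma_sets_mono, rule subsetI)
    fix A assume "A \<in> {{h \<in> cont_fun S. d \<le> h t} | t d. t \<in> S \<and> 0 < d}"
    then obtain t d where A: "A = {h \<in> cont_fun S. d \<le> h t}" "t \<in> S" "0 < d" by blast
    have "profile {(t, d)} h = {(t, d)} \<longleftrightarrow> d \<le> h t" for h
      unfolding profile_def by (auto simp: set_eq_iff)
    then have "A = {h \<in> cont_fun S. profile {(t, d)} h \<in> {{(t, d)}}}"
      unfolding A(1) by auto
    moreover have "finite {(t, d)}" "{(t, d)} \<subseteq> S \<times> {0<..}" using A by auto
    ultimately have "A \<in> cylinders S" unfolding cylinders_def by blast
    then show "A \<in> sigma_sets (cont_fun S) (cylinders S)" by (rule sigma_sets.Basic)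
  qed
  have "A \<in> sets ?N" if "A \<in> cylinders S" for A
  proof -
    obtain J \<C> where A: "A = {h \<in> cont_fun S. profile J h \<in> \<C>}" "finite J" "J \<subseteq> S \<times> {0<..}"
      using \<open>A \<in> cylinders S\<close> unfolding cylinders_def by blast
    have *: "profile J h = B \<longleftrightarrow> (\<forall>j\<in>J. snd j \<le> h (fst j) \<longleftrightarrow> j \<in> B)" if "B \<subseteq> J" for B h
      unfolding profile_def using that by auto
    have "{h \<in> space ?N. \<forall>j\<in>J. snd j \<le> h (fst j) \<longleftrightarrow> j \<in> B} \<in> sets ?N" for B
    proof (rule sets.sets_Collect_finite_All[OF _ A(2)])
      fix j assume "j \<in> J"
      then have "fst j \<in> S" using A(3) by auto
      note [measurable] = eval_measurable_borel_sigma[OF this]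
      show "{h \<in> space ?N. snd j \<le> h (fst j) \<longleftrightarrow> j \<in> B} \<in> sets ?N" by measurable
    qed
    then have "(\<Union>B\<in>Pow J \<inter> \<C>. {h \<in> space ?N. \<forall>j\<in>J. snd j \<le> h (fst j) \<longleftrightarrow> j \<in> B}) \<in> sets ?N"
      using A(2) by (intro sets.finite_UN) auto
    also have "(\<Union>B\<in>Pow J \<inter> \<C>. {h \<in> space ?N. \<forall>j\<in>J. snd j \<le> h (fst j) \<longleftrightarrow> j \<in> B}) =
        (\<Union>B\<in>Pow J \<inter> \<C>. {h \<in> space ?N. profile J h = B})"
      using * by auto
    also have "\<dots> = A" unfolding A(1) by (auto simp: profile_def)
    finally show ?thesis .
  qed
  then show "sigma_sets (cont_fun S) (cylinders S) \<subseteq> sets ?N"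
    using sets.sigma_sets_subset[of "cylinders S" ?N] by auto
qed

section \<open>Gluing functions on two disjoint closed sets, the inverse of taking both
  restrictions\<close>

definition glue :: "'a set \<Rightarrow> 'a set \<Rightarrow> ('a \<Rightarrow> real) \<times> ('a \<Rightarrow> real) \<Rightarrow> 'a \<Rightarrow> real" where
  "glue S1 S2 = (\<lambda>(h1, h2). restrict (\<lambda>t. if t \<in> S1 then h1 t else h2 t) (S1 \<union> S2))"

lemma glue_cont_fun:
  assumes S: "closed S1" "closed S2" "S1 \<inter> S2 = {}" and h: "h1 \<in> cont_fun S1" "h2 \<in> cont_fun S2"
  shows "glue S1 S2 (h1, h2) \<in> cont_fun (S1 \<union> S2)"
proof -
  have "continuous_on (S1 \<union> S2) (\<lambda>t. if t \<in> S1 then h1 t else h2 t)"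
    using S h by (intro continuous_on_cases) (auto simp: cont_fun_def)
  then have "continuous_on (S1 \<union> S2) (glue S1 S2 (h1, h2))"
    by (rule continuous_on_eq) (auto simp: glue_def)
  then show ?thesis using h by (auto simp: cont_fun_def glue_def)
qed

lemma restrict_glue:
  assumes "S1 \<inter> S2 = {}" "h1 \<in> cont_fun S1" "h2 \<in> cont_fun S2"
  shows "restrict (glue S1 S2 (h1, h2)) S1 = h1" "restrict (glue S1 S2 (h1, h2)) S2 = h2"
proof -
  have "h1 \<in> extensional S1" "h2 \<in> extensional S2" using assms by (auto simp: cont_fun_def)
  then show "restrict (glue S1 S2 (h1, h2)) S1 = h1" "restrict (glue S1 S2 (h1, h2)) S2 = h2"
    using assms(1) by (auto simp: glue_def fun_eq_iff restrict_def extensional_def)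
qed

lemma glue_restrict:
  assumes "h \<in> cont_fun (S1 \<union> S2)"
  shows "glue S1 S2 (restrict h S1, restrict h S2) = h"
proof -
  have "h \<in> extensional (S1 \<union> S2)" using assms by (auto simp: cont_fun_def)
  then show ?thesis by (auto simp: glue_def fun_eq_iff restrict_def extensional_def)
qed

text \<open>Each value of the glued function is an evaluation on one of the two factors, and
  evaluations generate the Borel sigma-field on the second countable union.\<close>

lemma glue_measurable:
  fixes S1 S2 :: "'a::metric_space set"
  assumes S: "closed S1" "closed S2" "S1 \<inter> S2 = {}" "second_countable (top_of_set (S1 \<union> S2))"
  shows "glue S1 S2 \<in> measurable
    (borel_sigma (compact_conv_topology S1) \<Otimes>\<^sub>M borel_sigma (compact_conv_topology S2))
    (borel_sigma (compact_conv_topology (S1 \<union> S2)))"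
proof (rule measurable_compact_conv[OF S(4)])
  let ?N = "borel_sigma (compact_conv_topology S1) \<Otimes>\<^sub>M borel_sigma (compact_conv_topology S2)"
  show "glue S1 S2 x \<in> cont_fun (S1 \<union> S2)" if "x \<in> space ?N" for x
    using that glue_cont_fun[OF S(1-3)] by (auto simp: space_pair_measure)
  fix t assume t: "t \<in> S1 \<union> S2"
  show "(\<lambda>x. glue S1 S2 x t) \<in> borel_measurable ?N"
  proof (cases "t \<in> S1")
    case True
    have "(\<lambda>x. fst x t) \<in> borel_measurable ?N"
      using eval_measurable_borel_sigma[OF True] by (rule measurable_compose[OF measurable_fst])
    then show ?thesis using True by (simp add: glue_def case_prod_beta)
  next
    case False
    then have "t \<in> S2" using t by simp
    then have "(\<lambda>x. snd x t) \<in> borel_measurable ?N"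
      using measurable_compose[OF measurable_snd eval_measurable_borel_sigma] by blast
    then show ?thesis using False t by (simp add: glue_def case_prod_beta)
  qed
qed

text \<open>The image of \<open>C\<close> in \<open>beta_coeff\<close> is a preimage under
  \<open>glue\<close>. For Borel \<open>C\<close> it is thus measurable in the product, and its
  product measure is the mass of \<open>C\<close> under the glued law.\<close>

lemma glue_vimage:
  assumes S: "closed S1" "closed S2" "S1 \<inter> S2 = {}" and C: "C \<subseteq> cont_fun (S1 \<union> S2)"
  shows "glue S1 S2 -` C \<inter> cont_fun S1 \<times> cont_fun S2 = (\<lambda>h. (restrict h S1, restrict h S2)) ` C"
proof (intro equalityI subsetI)
  fix x assume x: "x \<in> glue S1 S2 -` C \<inter> cont_fun S1 \<times> cont_fun S2"
  then obtain h1 h2 where x12: "x = (h1, h2)" "h1 \<in> cont_fun S1" "h2 \<in> cont_fun S2" by auto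
  then have "x = (\<lambda>h. (restrict h S1, restrict h S2)) (glue S1 S2 x)"
    using restrict_glue[OF S(3) x12(2,3)] by simp
  then show "x \<in> (\<lambda>h. (restrict h S1, restrict h S2)) ` C" using x by blast
next
  fix x assume "x \<in> (\<lambda>h. (restrict h S1, restrict h S2)) ` C"
  then obtain h where h: "h \<in> C" "x = (restrict h S1, restrict h S2)" by blast
  then have "h \<in> cont_fun (S1 \<union> S2)" using C by blast
  then show "x \<in> glue S1 S2 -` C \<inter> cont_fun S1 \<times> cont_fun S2"
    using h glue_restrict[of h S1 S2] by (auto intro: restrict_cont_fun)
qed

section \<open>From cylinder events to the mixing coefficient\<close>

lemma ennreal_le_double_iff: "ennreal r \<le> 2 * a \<longleftrightarrow> ennreal (r / 2) \<le> a"
proof (cases a)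
  case (real s)
  then have "2 * a = ennreal (2 * s)" by (simp add: ennreal_mult)
  then show ?thesis using real by (auto simp: ennreal_le_iff2)
qed (simp add: ennreal_mult_eq_top_iff)

theorem theorem2p1:
  fixes M :: "'w measure"
    and \<mu> :: "('a::metric_space \<Rightarrow> real) measure"
    and \<Phi> :: "'w \<Rightarrow> ('a \<Rightarrow> real) \<Rightarrow> nat"
    and \<eta> :: "'w \<Rightarrow> 'a \<Rightarrow> real"
    and S1 S2 :: "'a set"
  assumes "prob_space M"
    and "locally_compact_space (euclidean :: 'a topology)"
    and "max_id_process M \<mu> \<Phi> \<eta>"
    and "closed S1" "closed S2" "S1 \<inter> S2 = {}"
    and "second_countable (top_of_set (S1 \<union> S2))"
  shows "ennreal (beta_coeff M \<eta> S1 S2) \<le>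
    2 * (\<integral>\<^sup>+ f. emeasure M {\<omega> \<in> space M. not_less_on S1 f (\<eta> \<omega>) \<and> not_less_on S2 f (\<eta> \<omega>)} \<partial>\<mu>)"
    (is "_ \<le> 2 * ?I")
proof (cases "2 * ?I" rule: ennreal_cases)
  \<comment> \<open>A finite right-hand side becomes a real number \<open>r\<close>, so the real
    supremum in \<open>beta_coeff\<close> can be bounded term by term.\<close>
  case (real r)
  interpret max_id M \<mu> \<Phi> \<eta>
    using assms(1,3) by (simp add: max_id_def max_id_axioms_def)
  note S = assms(4-6)
  let ?S = "S1 \<union> S2"
  let ?B = "\<lambda>S. borel_sigma (compact_conv_topology S)"
  let ?L = "law_on M \<eta>"
  have "second_countable (subtopology (top_of_set ?S) S1)" "second_countable (subtopology (top_of_set ?S) S2)"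
    using assms(7) by (auto intro: second_countable_subtopology)
  then have sc: "second_countable (top_of_set S1)" "second_countable (top_of_set S2)"
    by (simp_all add: subtopology_subtopology inf.absorb2)
  note res = restrict_\<eta>_measurable[OF sc(1)] restrict_\<eta>_measurable[OF sc(2)] restrict_\<eta>_measurable[OF assms(7)]
  note nl = not_less_on_\<eta>_measurable[OF assms(2) S(1) sc(1)] not_less_on_\<eta>_measurable[OF assms(2) S(2) sc(2)]
  have L: "prob_space (?L S1)" "prob_space (?L S2)" "prob_space (?L ?S)"
    unfolding law_on_def using res by (auto intro: prob_space_distr)
  have L_sets: "sets (?L T) = sets (?B T)" and L_space: "space (?L T) = cont_fun T" for T
    unfolding law_on_def by simp_all
  note glue = glue_measurable[OF S assms(7)]
  have glue': "glue S1 S2 \<in> measurable (?L S1 \<Otimes>\<^sub>M ?L S2) (?B ?S)"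
    using glue by (simp add: measurable_cong_sets[OF sets_pair_measure_cong[OF L_sets L_sets] refl])
  define R where "R = distr (?L S1 \<Otimes>\<^sub>M ?L S2) (?B ?S) (glue S1 S2)"
  interpret L2: prob_space "?L S2" by (rule L)
  \<comment> \<open>Written over \<open>M \<Otimes>\<^sub>M M\<close>, the glued product law is that
    of two independent copies of \<open>\<eta>\<close>, one used on \<open>S1\<close> and the other
    on \<open>S2\<close>. This is the form treated by
    \<open>finite_dim_mixing_bound\<close>.\<close>
  have R_eq: "R = distr (M \<Otimes>\<^sub>M M) (?B ?S) (\<lambda>q. glue S1 S2 (restrict (\<eta> (fst q)) S1, restrict (\<eta> (snd q)) S2))"
  proof -
    have "?L S1 \<Otimes>\<^sub>M ?L S2 =
        distr (M \<Otimes>\<^sub>M M) (?B S1 \<Otimes>\<^sub>M ?B S2) (\<lambda>(x, y). (restrict (\<eta> x) S1, restrict (\<eta> y) S2))"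
      unfolding law_on_def using res L2.sigma_finite_measure_axioms
      by (intro pair_measure_distr) (simp_all add: law_on_def)
    then have "R = distr (distr (M \<Otimes>\<^sub>M M) (?B S1 \<Otimes>\<^sub>M ?B S2)
        (\<lambda>(x, y). (restrict (\<eta> x) S1, restrict (\<eta> y) S2))) (?B ?S) (glue S1 S2)"
      unfolding R_def by simp
    also have "\<dots> = distr (M \<Otimes>\<^sub>M M) (?B ?S) (glue S1 S2 \<circ> (\<lambda>(x, y). (restrict (\<eta> x) S1, restrict (\<eta> y) S2)))"
    proof (rule distr_distr[OF glue])
      show "(\<lambda>(x, y). (restrict (\<eta> x) S1, restrict (\<eta> y) S2)) \<in> measurable (M \<Otimes>\<^sub>M M) (?B S1 \<Otimes>\<^sub>M ?B S2)"
        unfolding case_prod_beta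
        using measurable_compose[OF measurable_fst res(1)] measurable_compose[OF measurable_snd res(2)]
        by (rule measurable_Pair)
    qed
    finally show ?thesis by (simp add: comp_def case_prod_beta)
  qed
  have pair_meas: "(\<lambda>q. glue S1 S2 (restrict (\<eta> (fst q)) S1, restrict (\<eta> (snd q)) S2)) \<in> measurable (M \<Otimes>\<^sub>M M) (?B ?S)"
    using measurable_compose[OF measurable_Pair[OF measurable_compose[OF measurable_fst res(1)]
          measurable_compose[OF measurable_snd res(2)]] glue] .
  interpret PP: pair_prob_space M M by unfold_locales
  have R: "prob_space R" unfolding R_eq using pair_meas by (rule PP.P.prob_space_distr)
  have cyl: "\<bar>measure (?L ?S) C - measure R C\<bar> \<le> r" if C_cyl: "C \<in> cylinders ?S" for C
  proof -
    obtain J \<C> where C: "C = {h \<in> cont_fun ?S. profile J h \<in> \<C>}" "finite J" "J \<subseteq> ?S \<times> {0<..}"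
      using C_cyl unfolding cylinders_def by blast
    have CB: "C \<in> sets (?B ?S)"
      unfolding sets_borel_sigma_cylinders[OF assms(7)] using C_cyl by (rule sigma_sets.Basic)
    \<comment> \<open>The additional threshold 1 keeps \<open>Q\<close> nonempty when
      \<open>J\<close> is empty, so that \<open>Min Q\<close> is meaningful.\<close>
    define Q where "Q = insert 1 (snd ` J)"
    have Q: "finite Q" "Q \<noteq> {}" "Q \<subseteq> {0<..}" unfolding Q_def using C(2,3) by auto
    define F1 where "F1 = fst ` J \<inter> S1"
    define F2 where "F2 = fst ` J \<inter> S2"
    have F: "finite F1" "finite F2" "F1 \<subseteq> S1" "F2 \<subseteq> S2" unfolding F1_def F2_def using C(2) by auto
    \<comment> \<open>The factor 2 is moved to the left so that the limit over the grids concerns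
      the bare integrals.\<close>
    have "ennreal (\<bar>measure (?L ?S) C - measure R C\<bar> / 2) \<le> ?I"
    proof (rule both_hit_prob_limit[OF Q F nl])
      fix n
      define Qn where "Qn = thresholds Q n"
      have Qn: "finite Qn" "Qn \<subseteq> {0<..}" "Q \<subseteq> Qn" unfolding Qn_def using thresholds_props[OF Q] by auto
      define V where "V F \<omega> = restrict (\<lambda>t. round_down Qn (\<eta> \<omega> t)) F" for F \<omega>
      define c where "c v1 v2 \<longleftrightarrow> profile J (\<lambda>t. if t \<in> S1 then v1 t else v2 t) \<in> \<C>" for v1 v2
      have rd: "d \<le> round_down Qn x \<longleftrightarrow> d \<le> x" if "(t, d) \<in> J" for t d x
      proof -
        have "d \<in> Q" using that unfolding Q_def by force
        then show ?thesis using le_round_down_iff[OF Qn(1), of d x] Q(3) Qn(3) by auto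
      qed
      \<comment> \<open>The profile reads only points of \<open>F1\<close> and \<open>F2\<close> and
        thresholds of \<open>Q\<close>, all of which belong to the grid, so it is the same for
        rounded and unrounded functions.\<close>
      have prof: "profile J (\<lambda>t. if t \<in> S1 then V F1 \<omega> t else V F2 \<omega>' t) =
          profile J (glue S1 S2 (restrict (\<eta> \<omega>) S1, restrict (\<eta> \<omega>') S2))" for \<omega> \<omega>'
      proof -
        have "d \<le> (if t \<in> S1 then V F1 \<omega> t else V F2 \<omega>' t) \<longleftrightarrow>
          d \<le> glue S1 S2 (restrict (\<eta> \<omega>) S1, restrict (\<eta> \<omega>') S2) t" if j: "(t, d) \<in> J" for t d
        proof -
          have "t \<in> fst ` J" using j by force
          moreover have "t \<in> S1 \<or> t \<in> S2" using j C(3) by auto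
          ultimately show ?thesis using rd[OF j] by (auto simp: V_def glue_def F1_def F2_def)
        qed
        then show ?thesis by (rule profile_cong)
      qed
      have g: "glue S1 S2 (restrict (\<eta> \<omega>) S1, restrict (\<eta> \<omega>) S2) = restrict (\<eta> \<omega>) ?S" for \<omega>
        by (auto simp: glue_def)
      have "measure (?L ?S) C = prob ((\<lambda>\<omega>. restrict (\<eta> \<omega>) ?S) -` C \<inter> space M)"
        unfolding law_on_def using res(3) CB by (rule measure_distr)
      also have "(\<lambda>\<omega>. restrict (\<eta> \<omega>) ?S) -` C \<inter> space M = {\<omega> \<in> space M. c (V F1 \<omega>) (V F2 \<omega>)}"
        unfolding c_def prof g C(1) using restrict_cont_fun[OF \<eta>_cont, of _ ?S] by auto
      finally have 1: "measure (?L ?S) C = prob {\<omega> \<in> space M. c (V F1 \<omega>) (V F2 \<omega>)}" .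
      have "measure R C = measure (M \<Otimes>\<^sub>M M)
          ((\<lambda>q. glue S1 S2 (restrict (\<eta> (fst q)) S1, restrict (\<eta> (snd q)) S2)) -` C \<inter> space (M \<Otimes>\<^sub>M M))"
        unfolding R_eq using pair_meas CB by (rule measure_distr)
      also have "(\<lambda>q. glue S1 S2 (restrict (\<eta> (fst q)) S1, restrict (\<eta> (snd q)) S2)) -` C \<inter> space (M \<Otimes>\<^sub>M M) =
          {q \<in> space (M \<Otimes>\<^sub>M M). c (V F1 (fst q)) (V F2 (snd q))}"
        unfolding c_def prof C(1) using measurable_space[OF pair_meas] by auto
      finally have 2: "measure R C = measure (M \<Otimes>\<^sub>M M) {q \<in> space (M \<Otimes>\<^sub>M M). c (V F1 (fst q)) (V F2 (snd q))}" .
      show "ennreal (\<bar>measure (?L ?S) C - measure R C\<bar> / 2) \<le> (\<integral>\<^sup>+ f. both_hit_prob F1 F2 (thresholds Q n) f \<partial>\<mu>)"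
        unfolding 1 2 ennreal_le_double_iff[symmetric] V_def Qn_def[symmetric]
        using F(1,2) Qn(1,2) by (rule finite_dim_mixing_bound)
    qed
    then have "ennreal \<bar>measure (?L ?S) C - measure R C\<bar> \<le> ennreal r"
      unfolding ennreal_le_double_iff[symmetric] real(2) .
    then show ?thesis using real(1) by (simp add: ennreal_le_iff)
  qed
  have bound: "\<bar>measure (?L ?S) C - measure (?L S1 \<Otimes>\<^sub>M ?L S2) ((\<lambda>h. (restrict h S1, restrict h S2)) ` C)\<bar> \<le> r"
    if C: "C \<in> sets (?B ?S)" for C
  proof -
    have "C \<subseteq> cont_fun ?S" using sets.sets_into_space[OF C] by simp
    have "measure R C = measure (?L S1 \<Otimes>\<^sub>M ?L S2) (glue S1 S2 -` C \<inter> space (?L S1 \<Otimes>\<^sub>M ?L S2))"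
      unfolding R_def using glue' C by (rule measure_distr)
    also have "glue S1 S2 -` C \<inter> space (?L S1 \<Otimes>\<^sub>M ?L S2) = (\<lambda>h. (restrict h S1, restrict h S2)) ` C"
      using glue_vimage[OF S \<open>C \<subseteq> cont_fun ?S\<close>] by (simp add: space_pair_measure L_space)
    finally have "measure (?L S1 \<Otimes>\<^sub>M ?L S2) ((\<lambda>h. (restrict h S1, restrict h S2)) ` C) = measure R C" ..
    moreover have "\<bar>measure (?L ?S) C - measure R C\<bar> \<le> r"
    proof (rule algebra_difference_bound[OF algebra_cylinders _ _ _ _ cyl])
      show "sets (?L ?S) = sigma_sets (cont_fun ?S) (cylinders ?S)"
        unfolding L_sets by (rule sets_borel_sigma_cylinders[OF assms(7)])
      show "sets R = sets (?L ?S)" unfolding L_sets R_def by simp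
      show "finite_measure (?L ?S)" "finite_measure R"
        using L(3) R by (simp_all add: prob_space.finite_measure)
      show "C \<in> sets (?L ?S)" using C L_sets by simp
    qed
    ultimately show ?thesis by simp
  qed
  have "beta_coeff M \<eta> S1 S2 \<le> r"
    unfolding beta_coeff_def
  proof (rule cSUP_least)
    show "sets (?B ?S) \<noteq> {}" using sets.top by blast
  qed (rule bound)
  then show ?thesis unfolding real(2) by (rule ennreal_leI)
next
  case top
  then show ?thesis by simp
qed

end
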